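(* Let $\mathcal{H}_2$ be the class of $2$-vertex extremal minimal bipartite matching covered graphs and $\mathcal{H}_4$ the class of edge extremal minimal bipartite matching covered graphs. Then $\mathcal{H}_4-C_6\subset\mathcal{H}_2$ (a proper containment).
   Context: All graphs are finite and loopless; parallel edges are allowed. For a graph $G=(V,E)$ write $n=|V|$ and $m=|E|$. A connected graph on four or more vertices is matching covered if every edge lies in some perfect matching. A matching covered graph is minimal if deleting any single edge yields a graph that is not matching covered. $V_2$ is the set of vertices of degree two. A minimal bipartite matching covered graph is $2$-vertex extremal if $|V_2|=2(m-n+2)$, and edge extremal if $|E|=\frac{3n-6}{2}$. $\mathcal{H}_4-C_6$ denotes the class $\mathcal{H}_4$ with the $6$-cycle $C_6$ removed. Classes are regarded up to isomorphism. *)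

theory Defs
  imports Complex_Main "HOL-Library.Infinite_Typeclass"
begin

record ('v, 'e) mgraph =
  verts :: "'v set"
  edges :: "'e set"
  ends :: "'e \<Rightarrow> 'v set"

text \<open>
  Parallel edges are distinct elements of \<open>edges G\<close> with the same ends; requiring exactly
  two ends rules out loops. Values of \<open>ends G\<close> outside \<open>edges G\<close> are irrelevant.
\<close>

definition multigraph :: "('v, 'e) mgraph \<Rightarrow> bool" where
  "multigraph G \<longleftrightarrow> finite (verts G) \<and> finite (edges G) \<and>
     (\<forall>e\<in>edges G. ends G e \<subseteq> verts G \<and> card (ends G e) = 2)"

definition degree :: "('v, 'e) mgraph \<Rightarrow> 'v \<Rightarrow> nat" where
  "degree G v = card {e \<in> edges G. v \<in> ends G e}"

definition adjacency :: "('v, 'e) mgraph \<Rightarrow> ('v \<times> 'v) set" where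
  "adjacency G = {(u, v). \<exists>e\<in>edges G. ends G e = {u, v}}"

definition connected_graph :: "('v, 'e) mgraph \<Rightarrow> bool" where
  "connected_graph G \<longleftrightarrow> verts G \<noteq> {} \<and>
     (\<forall>u\<in>verts G. \<forall>v\<in>verts G. (u, v) \<in> (adjacency G)\<^sup>*)"

definition bipartite :: "('v, 'e) mgraph \<Rightarrow> bool" where
  "bipartite G \<longleftrightarrow> (\<exists>A B. A \<union> B = verts G \<and> A \<inter> B = {} \<and>
     (\<forall>e\<in>edges G. \<exists>a\<in>A. \<exists>b\<in>B. ends G e = {a, b}))"

definition perfect_matching :: "('v, 'e) mgraph \<Rightarrow> 'e set \<Rightarrow> bool" where
  "perfect_matching G M \<longleftrightarrow> M \<subseteq> edges G \<and> (\<forall>v\<in>verts G. \<exists>!e. e \<in> M \<and> v \<in> ends G e)"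

definition matching_covered :: "('v, 'e) mgraph \<Rightarrow> bool" where
  "matching_covered G \<longleftrightarrow> multigraph G \<and> connected_graph G \<and> 4 \<le> card (verts G) \<and>
     (\<forall>e\<in>edges G. \<exists>M. perfect_matching G M \<and> e \<in> M)"

definition delete_edge :: "('v, 'e) mgraph \<Rightarrow> 'e \<Rightarrow> ('v, 'e) mgraph" where
  "delete_edge G e = G\<lparr>edges := edges G - {e}\<rparr>"

definition minimal_matching_covered :: "('v, 'e) mgraph \<Rightarrow> bool" where
  "minimal_matching_covered G \<longleftrightarrow> matching_covered G \<and>
     (\<forall>e\<in>edges G. \<not> matching_covered (delete_edge G e))"

definition V2 :: "('v, 'e) mgraph \<Rightarrow> 'v set" where
  "V2 G = {v \<in> verts G. degree G v = 2}"

definition two_vertex_extremal :: "('v, 'e) mgraph \<Rightarrow> bool" where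
  "two_vertex_extremal G \<longleftrightarrow> minimal_matching_covered G \<and> bipartite G \<and>
     int (card (V2 G)) = 2 * (int (card (edges G)) - int (card (verts G)) + 2)"

definition edge_extremal :: "('v, 'e) mgraph \<Rightarrow> bool" where
  "edge_extremal G \<longleftrightarrow> minimal_matching_covered G \<and> bipartite G \<and>
     real (card (edges G)) = (3 * real (card (verts G)) - 6) / 2"

definition isomorphic :: "('v, 'e) mgraph \<Rightarrow> ('w, 'f) mgraph \<Rightarrow> bool" where
  "isomorphic G H \<longleftrightarrow> (\<exists>f g. bij_betw f (verts G) (verts H) \<and> bij_betw g (edges G) (edges H) \<and>
     (\<forall>e\<in>edges G. ends H (g e) = f ` ends G e))"

definition iso_rel :: "(('v, 'e) mgraph \<times> ('v, 'e) mgraph) set" where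
  "iso_rel = {(G, H). multigraph G \<and> multigraph H \<and> isomorphic G H}"

text \<open>
  The classes below consist of isomorphism classes of graphs with vertices in \<open>'v\<close> and edges
  in \<open>'e\<close>. For infinite \<open>'v\<close> and \<open>'e\<close> every finite graph has a copy over these types.
\<close>

definition H2 :: "('v, 'e) mgraph set set" where
  "H2 = {G. two_vertex_extremal G} // iso_rel"

definition H4 :: "('v, 'e) mgraph set set" where
  "H4 = {G. edge_extremal G} // iso_rel"

text \<open>The cycle of length \<open>k\<close>, meaningful for \<open>k \<ge> 3\<close>; edge \<open>i\<close> joins \<open>i\<close> and \<open>i + 1\<close> modulo \<open>k\<close>.\<close>

definition cycle_graph :: "nat \<Rightarrow> (nat, nat) mgraph" where
  "cycle_graph k = \<lparr>verts = {..<k}, edges = {..<k}, ends = (\<lambda>i. {i, Suc i mod k})\<rparr>"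

definition C6 :: "('v, 'e) mgraph set" where
  "C6 = {G. multigraph G \<and> isomorphic G (cycle_graph 6)}"

end

theory Submission
  imports Defs
begin

text \<open>
  Contract a perfect matching of a bipartite graph with \<open>n = 2N\<close> vertices, directing the remaining
  edges from one colour class to the other. The graph is matching covered iff the resulting digraph
  is strongly connected, so a minimal graph yields a minimally strong digraph. Such a digraph with a
  cycle of length \<open>L\<close> has at most \<open>L + 2(N - L)\<close> arcs, and edge extremality means that it has
  \<open>2N - 3\<close> arcs; hence all its cycles have length at most 3. Together with the indispensability of the
  matching edges this forces every vertex to have indegree or outdegree 1 and excludes digons. What
  remains is a triangle, which comes from \<open>C\<^sub>6\<close>, or an arc \<open>y \<rightarrow> x\<close> together with
  paths \<open>x \<rightarrow> u \<rightarrow> y\<close>, in which case exactly two vertices of the graph do not have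
  degree two. The containment is proper because of \<open>C\<^sub>4\<close>.
\<close>

section \<open>Strongly connected digraphs\<close>

text \<open>Only the end points are confined to \<open>A\<close>, not the vertices in between. The
  same notion can thus speak of a subset of the vertices, such as those of a cycle.\<close>

definition strong_on :: "'a set \<Rightarrow> ('a \<times> 'a) set \<Rightarrow> bool" where
  "strong_on A D \<longleftrightarrow> (\<forall>x\<in>A. \<forall>y\<in>A. (x, y) \<in> D\<^sup>*)"

lemma strong_onD: "strong_on A D \<Longrightarrow> x \<in> A \<Longrightarrow> y \<in> A \<Longrightarrow> (x, y) \<in> D\<^sup>*"
  by (auto simp: strong_on_def)

lemma strong_on_mono: "strong_on A D \<Longrightarrow> D \<subseteq> D' \<Longrightarrow> strong_on A D'"
  unfolding strong_on_def using rtrancl_mono by blast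

section \<open>Paths and their arcs\<close>

lemma rtrancl_leaves:
  assumes "(x, y) \<in> R\<^sup>*" "x \<in> X" "y \<notin> X"
  obtains p q where "(p, q) \<in> R" "p \<in> X" "q \<notin> X"
  using assms by (induction) blast+

text \<open>Every vertex of the path but the first is entered by an arc; recording this later
  confines the path to \<open>A\<close>.\<close>

lemma distinct_path:
  assumes "(c, a) \<in> R\<^sup>*"
  obtains xs where "xs \<noteq> []" "distinct xs" "hd xs = c" "last xs = a"
    "successively (\<lambda>x y. (x, y) \<in> R) xs" "set xs \<subseteq> insert c (Range R)"
proof -
  have "\<exists>xs. xs \<noteq> [] \<and> distinct xs \<and> hd xs = c \<and> last xs = a \<and> successively (\<lambda>x y. (x, y) \<in> R) xs \<and>
      set xs \<subseteq> insert c (Range R)"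
    using assms
  proof induction
    case base
    show ?case by (rule exI[of _ "[c]"]) auto
  next
    case (step y z)
    then obtain xs where xs: "xs \<noteq> []" "distinct xs" "hd xs = c" "last xs = y"
      "successively (\<lambda>x y. (x, y) \<in> R) xs" "set xs \<subseteq> insert c (Range R)" by blast
    show ?case
    proof (cases "z \<in> set xs")
      case True
      \<comment> \<open>The new end point \<open>z\<close> is already on the path, which is
        therefore cut off right behind \<open>z\<close>.\<close>
      then obtain us vs where "xs = us @ z # vs" by (meson split_list)
      then have "xs = (us @ [z]) @ vs" by simp
      with xs show ?thesis
        by (intro exI[of _ "us @ [z]"]) (auto simp: successively_append_iff hd_append split: if_splits)
    next
      case False
      with xs step show ?thesis
        by (intro exI[of _ "xs @ [z]"]) (auto simp: successively_append_iff)
    qed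
  qed
  then show ?thesis using that by blast
qed

text \<open>\<open>zip xs (tl xs)\<close> lists the arcs along \<open>xs\<close>. Using no other
  arcs keeps their number below that of the vertices, as the count for cycles requires.\<close>

lemma path_arcs_reach:
  assumes "successively (\<lambda>x y. (x, y) \<in> R) xs" "x \<in> set xs"
  shows "(hd xs, x) \<in> (set (zip xs (tl xs)))\<^sup>*" "(x, last xs) \<in> (set (zip xs (tl xs)))\<^sup>*"
    "set (zip xs (tl xs)) \<subseteq> R"
  using assms
proof -
  have "(\<forall>x\<in>set xs. (hd xs, x) \<in> (set (zip xs (tl xs)))\<^sup>* \<and> (x, last xs) \<in> (set (zip xs (tl xs)))\<^sup>*) \<and>
      set (zip xs (tl xs)) \<subseteq> R"
    using assms(1)
  proof (induction xs)
    case (Cons u ys)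
    show ?case
    proof (cases ys)
      case (Cons v zs)
      let ?C = "set (zip ys (tl ys))" and ?C' = "set (zip (u # ys) ys)"
      have C': "?C' = insert (u, v) ?C" by (simp add: Cons)
      then have sub: "?C\<^sup>* \<subseteq> ?C'\<^sup>*" by (intro rtrancl_mono) auto
      have IH: "(v, y) \<in> ?C'\<^sup>*" "(y, last ys) \<in> ?C'\<^sup>*" if "y \<in> set ys" for y
        using Cons.IH Cons.prems Cons that sub by auto
      then have "(u, y) \<in> ?C'\<^sup>*" if "y \<in> set ys" for y
        using converse_rtrancl_into_rtrancl[of u v ?C' y] IH(1)[OF that] C' by blast
      moreover have "(u, last ys) \<in> ?C'\<^sup>*"
        using calculation Cons by simp
      ultimately show ?thesis
        using IH Cons.IH Cons.prems Cons C' by auto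
    qed auto
  qed simp
  then show "(hd xs, x) \<in> (set (zip xs (tl xs)))\<^sup>*" "(x, last xs) \<in> (set (zip xs (tl xs)))\<^sup>*"
    "set (zip xs (tl xs)) \<subseteq> R"
    using assms(2) by auto
qed

section \<open>Branchings and the number of arcs of a minimally strong digraph\<close>

lemma out_branching:
  assumes "finite A" "W \<subseteq> A" "W \<noteq> {}" "D \<subseteq> A \<times> A" "strong_on A D"
  obtains F where "F \<subseteq> D" "card F \<le> card (A - W)" "\<And>a. a \<in> A \<Longrightarrow> \<exists>w\<in>W. (w, a) \<in> F\<^sup>*"
proof -
  have "\<exists>F\<subseteq>D. card F \<le> card (A - W) \<and> (\<forall>a\<in>A. \<exists>w\<in>W. (w, a) \<in> F\<^sup>*)"
    using assms
  proof (induction "card (A - W)" arbitrary: W)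
    case 0
    then have "A = W" by auto
    then show ?case by (intro exI[of _ "{}"]) auto
  next
    \<comment> \<open>By strong connectedness some arc leaves \<open>W\<close>. Its head is added to
      \<open>W\<close>, so that each vertex outside costs one arc.\<close>
    case (Suc n)
    then have "A - W \<noteq> {}" by force
    then obtain t w where "t \<in> A - W" "w \<in> W" using Suc by blast
    then obtain x y where xy: "(x, y) \<in> D" "x \<in> W" "y \<notin> W"
      using Suc rtrancl_leaves[of w t D W] strong_onD[of A D w t] by blast
    have y: "y \<in> A" using xy Suc by auto
    have "A - W = insert y (A - insert y W)" using xy y by auto
    then have c: "card (A - W) = Suc (card (A - insert y W))"
      using Suc.prems(1) by (metis card_insert_disjoint finite_Diff insertI1 Diff_iff)
    then obtain F where F: "F \<subseteq> D" "card F \<le> card (A - insert y W)"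
      "\<forall>a\<in>A. \<exists>w\<in>insert y W. (w, a) \<in> F\<^sup>*"
      using Suc.hyps(1)[of "insert y W"] Suc.hyps(2) Suc.prems y by auto
    have sub: "F\<^sup>* \<subseteq> (insert (x, y) F)\<^sup>*" by (intro rtrancl_mono) auto
    have "\<exists>w\<in>W. (w, a) \<in> (insert (x, y) F)\<^sup>*" if a: "a \<in> A" for a
    proof -
      obtain w where w: "w \<in> insert y W" "(w, a) \<in> F\<^sup>*"
        using F(3) a by blast
      show ?thesis
      proof (cases "w = y")
        case True
        then have "(y, a) \<in> (insert (x, y) F)\<^sup>*" using w(2) sub by auto
        then have "(x, a) \<in> (insert (x, y) F)\<^sup>*"
          by (rule converse_rtrancl_into_rtrancl[rotated]) simp
        then show ?thesis using xy(2) by auto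
      next
        case False
        then have "w \<in> W" "(w, a) \<in> (insert (x, y) F)\<^sup>*" using w sub by auto
        then show ?thesis by (rule bexI[rotated])
      qed
    qed
    moreover have "card (insert (x, y) F) \<le> card (A - W)"
      using F c by (intro card_insert_le_m1) auto
    ultimately show ?case using F xy by (intro exI[of _ "insert (x, y) F"]) auto
  qed
  then show ?thesis using that by blast
qed

text \<open>A forest growing out of \<open>W\<close> and one leading into \<open>W\<close>, each
  with at most one arc per vertex outside, suffice together with \<open>C\<close> to make
  \<open>A\<close> strong. Minimality then leaves no further arcs.\<close>

lemma minimal_strong_card_le:
  assumes "finite A" "W \<subseteq> A" "W \<noteq> {}" "D \<subseteq> A \<times> A" "strong_on A D"
    and minimal: "\<And>a. a \<in> D \<Longrightarrow> \<not> strong_on A (D - {a})"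
    and C: "C \<subseteq> D" "strong_on W C"
  shows "card D \<le> card C + 2 * card (A - W)"
proof -
  obtain F where F: "F \<subseteq> D" "card F \<le> card (A - W)" "\<And>a. a \<in> A \<Longrightarrow> \<exists>w\<in>W. (w, a) \<in> F\<^sup>*"
    using out_branching[OF assms(1-5)] by blast
  \<comment> \<open>The forest leading into \<open>W\<close> is an out-branching of the reversed
    digraph.\<close>
  have "D\<inverse> \<subseteq> A \<times> A" "strong_on A (D\<inverse>)"
    using assms(4,5) by (auto simp: strong_on_def rtrancl_converse)
  then obtain F' where F': "F' \<subseteq> D\<inverse>" "card F' \<le> card (A - W)"
    "\<And>a. a \<in> A \<Longrightarrow> \<exists>w\<in>W. (w, a) \<in> F'\<^sup>*"
    using out_branching[OF assms(1-3), of "D\<inverse>"] by blast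
  let ?T = "C \<union> F \<union> F'\<inverse>"
  have sub: "C\<^sup>* \<subseteq> ?T\<^sup>*" "F\<^sup>* \<subseteq> ?T\<^sup>*" "(F'\<inverse>)\<^sup>* \<subseteq> ?T\<^sup>*"
    by (intro rtrancl_mono; auto)+
  have "strong_on A ?T"
    unfolding strong_on_def
  proof (intro ballI)
    fix x y assume "x \<in> A" "y \<in> A"
    obtain u v where "u \<in> W" "(u, x) \<in> F'\<^sup>*" "v \<in> W" "(v, y) \<in> F\<^sup>*"
      using F(3) F'(3) \<open>x \<in> A\<close> \<open>y \<in> A\<close> by metis
    moreover have "(u, v) \<in> C\<^sup>*" using C \<open>u \<in> W\<close> \<open>v \<in> W\<close> by (auto simp: strong_on_def)
    ultimately have "(x, u) \<in> ?T\<^sup>*" "(u, v) \<in> ?T\<^sup>*" "(v, y) \<in> ?T\<^sup>*"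
      using sub by (auto simp: rtrancl_converse)
    then show "(x, y) \<in> ?T\<^sup>*" by (meson rtrancl_trans)
  qed
  then have "a \<in> ?T" if "a \<in> D" for a
    using minimal[OF that] strong_on_mono[of A ?T "D - {a}"] C(1) F(1) F'(1) by blast
  then have "D \<subseteq> ?T" by (rule subsetI)
  have "?T \<subseteq> D" using C(1) F(1) F'(1) by blast
  then have "finite ?T"
    using assms(1,4) by (meson finite_SigmaI finite_subset)
  then have "card D \<le> card ?T" using \<open>D \<subseteq> ?T\<close> by (intro card_mono)
  also have "\<dots> \<le> card C + card F + card (F'\<inverse>)"
    by (meson card_Un_le add_mono le_trans order_refl)
  finally show ?thesis using F F' by simp
qed

section \<open>Closed sets and rotations along a path\<close>

lemma closed_imp_all:
  assumes "strong_on A D" "X \<subseteq> A" "X \<noteq> {}" "D `` X \<subseteq> X"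
  shows "X = A"
proof (rule ccontr)
  assume "X \<noteq> A"
  then obtain x y where "x \<in> X" "y \<in> A" "y \<notin> X" "x \<in> A" using assms by blast
  then show False using rtrancl_leaves[of x y D X] strong_onD[OF assms(1), of x y] assms(4) by blast
qed

lemma not_strong_closed:
  assumes "\<not> strong_on A R" "R \<subseteq> A \<times> A"
  obtains X where "X \<subseteq> A" "X \<noteq> {}" "X \<noteq> A" "R `` X \<subseteq> X"
proof -
  obtain x y where xy: "x \<in> A" "y \<in> A" "(x, y) \<notin> R\<^sup>*" using assms by (auto simp: strong_on_def)
  \<comment> \<open>What \<open>x\<close> reaches is closed under arcs and misses
    \<open>y\<close>.\<close>
  let ?X = "{z \<in> A. (x, z) \<in> R\<^sup>*}"
  show ?thesis
    by (rule that[of ?X]) (use xy assms in \<open>auto intro: rtrancl_into_rtrancl\<close>)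
qed

text \<open>The permutation rotates \<open>xs\<close> and fixes all other elements. Only the step
  from the last entry back to the first may fail to lie in \<open>R\<close>; a prescribed edge will
  be put there.\<close>

lemma cycle_permutation:
  assumes "finite A" "distinct xs" "xs \<noteq> []" "successively (\<lambda>x y. (x, y) \<in> R) xs"
    and "set xs \<subseteq> A" "\<And>x. x \<in> A \<Longrightarrow> (x, x) \<in> R"
  shows "\<exists>p. bij_betw p A A \<and> p (last xs) = hd xs \<and> (\<forall>x\<in>A - {last xs}. (x, p x) \<in> R) \<and>
    (\<forall>x\<in>A - set xs. p x = x)"
  using assms
proof (induction xs)
  case (Cons c ys)
  show ?case
  proof (cases "ys = []")
    case True
    then show ?thesis using Cons.prems by (intro exI[of _ id]) (auto simp: bij_betw_def)
  next
    case False
    then obtain p where p: "bij_betw p A A" "p (last ys) = hd ys"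
      "\<forall>x\<in>A - {last ys}. (x, p x) \<in> R" "\<forall>x\<in>A - set ys. p x = x"
      using Cons by (auto simp: successively_Cons)
    have cd: "(c, hd ys) \<in> R" using Cons False by (auto simp: successively_Cons)
    have mem: "c \<in> A" "last ys \<in> A" "hd ys \<in> A" "c \<noteq> last ys" "c \<notin> set ys" "hd ys \<in> set ys"
      "last ys \<in> set ys"
      using Cons.prems False by auto
    have pc: "p c = c" using p(4) mem by auto
    \<comment> \<open>\<open>p\<close> rotates \<open>ys\<close>; now \<open>c\<close> is spliced in
      between \<open>last ys\<close> and \<open>hd ys\<close>.\<close>
    define q where "q = p(last ys := c, c := hd ys)"
    have pA: "p ` A = A" using p(1) by (simp add: bij_betw_def)
    have q: "q (last ys) = c" "q c = hd ys" "\<And>x. x \<noteq> c \<Longrightarrow> x \<noteq> last ys \<Longrightarrow> q x = p x"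
      using mem by (simp_all add: q_def)
    have "y \<in> q ` A" if y: "y \<in> A" for y
    proof -
      obtain x where x: "x \<in> A" "y = p x" using pA y by blast
      then have "y = q (if x = c then last ys else if x = last ys then c else x)"
        using q p(2) pc by simp
      then show ?thesis using x mem by auto
    qed
    moreover have "q ` A \<subseteq> A" using mem pA by (auto simp: q_def)
    ultimately have "bij_betw q A A"
      using finite_surj_inj[OF Cons.prems(1), of q] by (auto simp: bij_betw_def)
    moreover have "(x, q x) \<in> R" if "x \<in> A - {last ys}" for x
      using p(3) q(2) q(3)[of x] cd that by (cases "x = c") auto
    moreover have "q x = x" if "x \<in> A - set (c # ys)" for x
    proof -
      have "x \<noteq> c" "x \<noteq> last ys" using that mem by auto
      then show ?thesis using p(4) q(3) that by auto
    qed
    ultimately show ?thesis using q(1) False by (intro exI[of _ q]) simp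
  qed
qed simp

section \<open>Minimally strong digraphs with few arcs more than a tree\<close>

text \<open>The digraph obtained from an edge extremal graph by contracting a perfect matching. The
  assumption \<open>separation\<close> is what indispensability of the matching edge at \<open>v\<close> amounts to.\<close>

locale extremal_digraph =
  fixes A :: "'a set" and D :: "('a \<times> 'a) set"
  assumes finite: "finite A" and arcs: "D \<subseteq> A \<times> A" and irrefl: "(x, x) \<notin> D"
    and strong: "strong_on A D" and minimal: "a \<in> D \<Longrightarrow> \<not> strong_on A (D - {a})"
    and card_arcs: "card D + 3 = 2 * card A"
    and separation: "v \<in> A \<Longrightarrow> \<exists>X z. v \<in> X \<and> z \<notin> X \<and> D `` X \<subseteq> insert z (X - {v})"
begin

text \<open>For a cycle of length L and N = \<open>card A\<close>, the branching bound with the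
  cycle as core reads 2N - 3 \<le> L + 2(N - L), that is L \<le> 3.\<close>

lemma cycle_length_le:
  assumes "distinct xs" "xs \<noteq> []" "successively (\<lambda>x y. (x, y) \<in> D) xs" "(last xs, hd xs) \<in> D"
    "set xs \<subseteq> A"
  shows "length xs \<le> 3"
proof -
  let ?C = "insert (last xs, hd xs) (set (zip xs (tl xs)))"
  have sub: "(set (zip xs (tl xs)))\<^sup>* \<subseteq> ?C\<^sup>*" by (intro rtrancl_mono) auto
  have "strong_on (set xs) ?C"
    unfolding strong_on_def
  proof (intro ballI)
    fix x y assume "x \<in> set xs" "y \<in> set xs"
    then have "(x, last xs) \<in> ?C\<^sup>*" "(hd xs, y) \<in> ?C\<^sup>*"
      using path_arcs_reach[OF assms(3)] sub by blast+
    then show "(x, y) \<in> ?C\<^sup>*"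
      by (meson insertI1 rtrancl_into_rtrancl rtrancl_trans)
  qed
  moreover have "?C \<subseteq> D" using assms path_arcs_reach(3)[OF assms(3), of "hd xs"] by auto
  ultimately have "card D \<le> card ?C + 2 * card (A - set xs)"
    using assms minimal by (intro minimal_strong_card_le[OF finite _ _ arcs strong]) auto
  moreover have "card ?C \<le> length xs"
  proof -
    have "card (set (zip xs (tl xs))) \<le> length xs - 1"
      using card_length[of "zip xs (tl xs)"] by simp
    then show ?thesis using card_insert_le_m1[of "length xs"] assms by simp
  qed
  moreover have "card (A - set xs) = card A - length xs" "length xs \<le> card A"
    using assms finite by (metis card_Diff_subset distinct_card finite_set)
      (metis assms(1,5) card_mono distinct_card finite)
  ultimately show ?thesis using card_arcs by linarith
qed

text \<open>A path from \<open>b\<close> back to \<open>a\<close> closes up with the arc to a cycle,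
  which has at most three vertices.\<close>

lemma arc_in_short_cycle:
  assumes "(a, b) \<in> D"
  shows "(b, a) \<in> D \<or> (\<exists>c. (b, c) \<in> D \<and> (c, a) \<in> D)"
proof -
  have ab: "a \<in> A" "b \<in> A" "a \<noteq> b" using assms arcs irrefl by auto
  obtain xs where xs: "xs \<noteq> []" "distinct xs" "hd xs = b" "last xs = a"
    "successively (\<lambda>x y. (x, y) \<in> D) xs" "set xs \<subseteq> insert b (Range D)"
    using distinct_path[OF strong_onD[OF strong ab(2,1)]] by blast
  then have "set xs \<subseteq> A" using ab(2) arcs by blast
  then have "length xs \<le> 3" using xs assms by (intro cycle_length_le) auto
  then show ?thesis using xs ab
    by (cases xs rule: remdups_adj.cases; cases "tl (tl xs)") auto
qed

text \<open>With two neighbours on either side of \<open>v\<close>, the set given by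
  \<open>separation\<close> would yield a cycle of length four.\<close>

lemma single_in_or_out:
  assumes "(v, w1) \<in> D" "(v, w2) \<in> D" "(u1, v) \<in> D" "(u2, v) \<in> D"
  shows "w1 = w2 \<or> u1 = u2"
proof (rule ccontr)
  assume ne: "\<not> ?thesis"
  have "v \<in> A" using assms arcs by auto
  then obtain X z where X: "v \<in> X" "z \<notin> X" "\<And>x y. x \<in> X \<Longrightarrow> (x, y) \<in> D \<Longrightarrow> y = z \<or> y \<in> X \<and> y \<noteq> v"
    using separation[of v] by blast
  \<comment> \<open>Of two distinct neighbours at most one is \<open>z\<close>. This puts
    \<open>w\<close> into \<open>X\<close>; and \<open>u\<close> lies outside \<open>X\<close>,
    because no arc from \<open>X\<close> enters \<open>v\<close>.\<close>
  obtain w where w: "(v, w) \<in> D" "w \<in> X" using assms ne X by metis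
  obtain u where u: "(u, v) \<in> D" "u \<noteq> z" using assms ne by metis
  have "u \<notin> X" "w \<noteq> v" "z \<noteq> v" using X u w irrefl by blast+
  \<comment> \<open>The short cycle through \<open>(u, v)\<close> leaves \<open>X\<close> between
    \<open>v\<close> and \<open>u\<close>, which is possible only via \<open>z\<close>.\<close>
  have "(v, u) \<notin> D" using X \<open>u \<notin> X\<close> u by blast
  then obtain c where "(v, c) \<in> D" "(c, u) \<in> D" using arc_in_short_cycle[OF u(1)] by blast
  then have zu: "(z, u) \<in> D" using X u \<open>u \<notin> X\<close> by metis
  \<comment> \<open>The short cycle through \<open>(v, w)\<close> has to leave \<open>X\<close>
    before it returns to \<open>v\<close>, again via \<open>z\<close>. The two cycles combine to
    \<open>v\<close>, \<open>w\<close>, \<open>z\<close>, \<open>u\<close>.\<close>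
  have "(w, v) \<notin> D" using X w by blast
  then obtain d where "(w, d) \<in> D" "(d, v) \<in> D" using arc_in_short_cycle[OF w(1)] by blast
  then have "(w, z) \<in> D" using X w by metis
  then have "length [v, w, z, u] \<le> 3"
    using w u zu X \<open>u \<notin> X\<close> \<open>w \<noteq> v\<close> arcs by (intro cycle_length_le) auto
  then show False by simp
qed

text \<open>The detour through \<open>w\<close> makes the direct arc redundant, against
  minimality.\<close>

lemma no_shortcut:
  assumes "(x, w) \<in> D" "(w, y) \<in> D" shows "(x, y) \<notin> D"
proof
  assume xy: "(x, y) \<in> D"
  have "(x, w) \<in> D - {(x, y)}" "(w, y) \<in> D - {(x, y)}" using assms irrefl by auto
  then have "(x, y) \<in> (D - {(x, y)})\<^sup>*" by (meson r_into_rtrancl rtrancl_into_rtrancl)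
  then have "D \<subseteq> (D - {(x, y)})\<^sup>*" by auto
  then have "D\<^sup>* \<subseteq> (D - {(x, y)})\<^sup>*" by (metis rtrancl_idemp rtrancl_mono)
  then have "strong_on A (D - {(x, y)})" using strong unfolding strong_on_def by blast
  then show False using minimal xy by blast
qed

lemma no_digon:
  assumes "(x, v) \<in> D" shows "(v, x) \<notin> D"
proof
  assume vx: "(v, x) \<in> D"
  \<comment> \<open>Because of \<open>w\<close>, the only in-neighbour of \<open>x\<close> is
    \<open>v\<close>. The short cycle through \<open>(x, w)\<close> thus returns via
    \<open>v\<close>, and \<open>(x, v)\<close> has a detour through \<open>w\<close>.\<close>
  have *: False if "(x, v) \<in> D" "(v, x) \<in> D" "(x, w) \<in> D" "w \<noteq> v" for x v w
  proof -
    have "u = v" if "(u, x) \<in> D" for u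
      using single_in_or_out[of x v w u v] that \<open>(x, v) \<in> D\<close> \<open>(v, x) \<in> D\<close> \<open>(x, w) \<in> D\<close> \<open>w \<noteq> v\<close> by blast
    then have "(w, v) \<in> D" using arc_in_short_cycle[OF \<open>(x, w) \<in> D\<close>] \<open>w \<noteq> v\<close> by metis
    then show False using no_shortcut that by blast
  qed
  have "finite D" using arcs finite by (meson finite_SigmaI finite_subset)
  have "x \<noteq> v" using assms irrefl by blast
  then have "card {(x, v), (v, x)} = 2" by auto
  then have "2 \<le> card D"
    using assms vx \<open>finite D\<close> by (metis card_mono empty_subsetI insert_subset)
  moreover have "card {x, v} = 2" using \<open>x \<noteq> v\<close> by auto
  \<comment> \<open>On two vertices the arc count allows a single arc, whereas a digon has two.
    Hence some arc leaves the digon and \<open>*\<close> applies at its tail.\<close>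
  ultimately have "{x, v} \<noteq> A" using card_arcs by auto
  then have "\<not> D `` {x, v} \<subseteq> {x, v}"
    using closed_imp_all[OF strong, of "{x, v}"] assms arcs by auto
  then show False using *[of x v] *[of v x] assms vx by auto
qed

lemma arc_in_triangle:
  assumes "(a, b) \<in> D"
  obtains c where "(b, c) \<in> D" "(c, a) \<in> D"
  using arc_in_short_cycle[OF assms] no_digon[OF assms] by blast

text \<open>\<open>single_in_or_out\<close> is used at both ends: it leaves \<open>x\<close> a
  single in-neighbour \<open>y\<close>, so all triangles through arcs leaving \<open>x\<close> close
  via \<open>y\<close>; now \<open>y\<close> has two in-neighbours and hence only one
  out-neighbour.\<close>

lemma branching_vertex:
  assumes "(x, u1) \<in> D" "(x, u2) \<in> D" "u1 \<noteq> u2"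
  obtains y where "(y, x) \<in> D" "\<And>u. (u, x) \<in> D \<Longrightarrow> u = y" "\<And>u. (x, u) \<in> D \<Longrightarrow> (u, y) \<in> D"
    "\<And>w. (y, w) \<in> D \<Longrightarrow> w = x"
proof -
  obtain y where y: "(y, x) \<in> D" using arc_in_triangle assms(1) by blast
  have uniq: "u = y" if "(u, x) \<in> D" for u
    using single_in_or_out[OF assms(1,2) that y] assms(3) by blast
  have ret: "(u, y) \<in> D" if "(x, u) \<in> D" for u
    using arc_in_triangle[OF that] uniq by metis
  have "w = x" if "(y, w) \<in> D" for w
    using single_in_or_out[OF that y ret[OF assms(1)] ret[OF assms(2)]] assms(3) by blast
  then show ?thesis using that y uniq ret by blast
qed

section \<open>The shape of the digraph\<close>

lemma out_arc: assumes "a \<in> A" obtains b where "(a, b) \<in> D"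
proof -
  have "A \<noteq> {a}" using card_arcs by auto
  then show ?thesis
    using closed_imp_all[OF strong, of "{a}"] assms that by blast
qed

lemma in_arc: assumes "a \<in> A" obtains b where "(b, a) \<in> D"
proof -
  obtain c where "(a, c) \<in> D" using out_arc[OF assms] .
  then show ?thesis using arc_in_triangle that by metis
qed

text \<open>If no vertex branches, there are as many arcs as vertices, and the arc count leaves
  three of each. Otherwise a branching vertex \<open>x\<close> and its in-neighbour \<open>y\<close>
  determine the digraph.\<close>

lemma theta_or_triangle:
  obtains (theta) x y where "x \<in> A" "y \<in> A" "card (D `` {x}) \<noteq> 1" "card (D\<inverse> `` {y}) \<noteq> 1"
    "\<And>a. a \<in> A - {x} \<Longrightarrow> card (D `` {a}) = 1" "\<And>a. a \<in> A - {y} \<Longrightarrow> card (D\<inverse> `` {a}) = 1"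
  | (triangle) a b c where "distinct [a, b, c]" "A = {a, b, c}" "D = {(a, b), (b, c), (c, a)}"
proof (cases "\<exists>x u1 u2. (x, u1) \<in> D \<and> (x, u2) \<in> D \<and> u1 \<noteq> u2")
  case True
  then obtain x u1 u2 where x: "(x, u1) \<in> D" "(x, u2) \<in> D" "u1 \<noteq> u2" by blast
  obtain y where y: "(y, x) \<in> D" "\<And>u. (u, x) \<in> D \<Longrightarrow> u = y" "\<And>u. (x, u) \<in> D \<Longrightarrow> (u, y) \<in> D"
    "\<And>w. (y, w) \<in> D \<Longrightarrow> w = x"
    using branching_vertex[OF x] by blast
  \<comment> \<open>An out-neighbour \<open>u\<close> of \<open>x\<close> with an arc to some
    \<open>w \<noteq> y\<close> would branch as well. Its only in-neighbour \<open>x\<close> could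
    then have no out-neighbour but \<open>u\<close>.\<close>
  have out: "w = y" if xu: "(x, u) \<in> D" and uw: "(u, w) \<in> D" for u w
  proof (rule ccontr)
    assume "w \<noteq> y"
    from branching_vertex[OF uw y(3)[OF xu] this] obtain x' where
      x': "\<And>t. (t, u) \<in> D \<Longrightarrow> t = x'" "\<And>w. (x', w) \<in> D \<Longrightarrow> w = u"
      by metis
    have "x = x'" using x'(1)[OF xu] .
    then show False using x'(2) x by blast
  qed
  \<comment> \<open>No arc leaves the vertices found so far, so they exhaust
    \<open>A\<close>.\<close>
  have "D `` ({x, y} \<union> D `` {x}) \<subseteq> {x, y} \<union> D `` {x}" by (auto dest: out y(4))
  moreover have "{x, y} \<union> D `` {x} \<subseteq> A" using arcs y(1) by blast
  ultimately have "{x, y} \<union> D `` {x} = A"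
    by (intro closed_imp_all[OF strong]) auto
  then have A: "a = x \<or> a = y \<or> (x, a) \<in> D" if "a \<in> A" for a using that by blast
  have xy: "x \<in> A" "y \<in> A" using y(1) arcs by auto
  have one: "card S = 1" if "s \<in> S" "\<And>t. t \<in> S \<Longrightarrow> t = s" for s and S :: "'a set"
    using that by (metis is_singletonI' is_singleton_altdef empty_iff)
  show ?thesis
  proof (rule theta[OF xy])
    show "card (D `` {x}) \<noteq> 1"
      using x by (metis Image_singleton_iff card_1_singletonE singletonD)
    show "card (D\<inverse> `` {y}) \<noteq> 1"
      using x y(3) by (metis Image_singleton_iff card_1_singletonE converseI singletonD)
    fix a
    show "card (D `` {a}) = 1" if a: "a \<in> A - {x}"
    proof -
      obtain b where "(a, b) \<in> D" using a out_arc by blast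
      moreover have "w = (if a = y then x else y)" if "(a, w) \<in> D" for w
        using y(4)[of w] out[of a w] A[of a] a that by auto
      ultimately show ?thesis by (intro one[of b]) auto
    qed
    show "card (D\<inverse> `` {a}) = 1" if a: "a \<in> A - {y}"
    proof -
      obtain b where "(b, a) \<in> D" using a in_arc by blast
      moreover have "t = (if a = x then y else x)" if "(t, a) \<in> D" for t
      proof -
        have "t \<in> A" using that arcs by auto
        then consider "t = x" | "t = y" | "(x, t) \<in> D" using A by blast
        then show ?thesis
        proof cases
          case 1
          then show ?thesis using that irrefl by auto
        next
          case 2
          then show ?thesis using y(4) that by simp
        next
          case 3
          then show ?thesis using out[OF 3 that] a by simp
        qed
      qed
      ultimately show ?thesis by (intro one[of b]) auto
    qed
  qed
next
  case False
  have "\<forall>a\<in>A. \<exists>b. (a, b) \<in> D" using out_arc by (metis (full_types))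
  then obtain f where f: "\<forall>a\<in>A. (a, f a) \<in> D" by (rule bchoice[THEN exE])
  have "d \<in> (\<lambda>a. (a, f a)) ` A" if "d \<in> D" for d
  proof -
    obtain a b where d: "d = (a, b)" by (cases d)
    then have "a \<in> A" using that arcs by blast
    then have "b = f a" using False f that d by blast
    then show ?thesis using d \<open>a \<in> A\<close> by blast
  qed
  then have "D = (\<lambda>a. (a, f a)) ` A" using f by blast
  then have "card D = card A" by (simp add: card_image inj_on_def)
  then have c3: "card A = 3" "card D = 3" using card_arcs by auto
  then have "A \<noteq> {}" by auto
  then obtain a where "(a, f a) \<in> D" using f by blast
  then obtain b c where abc: "(a, b) \<in> D" "(b, c) \<in> D" "(c, a) \<in> D"
    using arc_in_triangle by metis
  then have "a \<noteq> b" "b \<noteq> c" "c \<noteq> a" using irrefl by blast+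
  then have d: "distinct [a, b, c]" by auto
  have "finite D" using c3 card.infinite by fastforce
  then have "{(a, b), (b, c), (c, a)} = D"
    using abc d c3 by (intro card_subset_eq) auto
  moreover have "{a, b, c} = A"
    using abc d c3 finite arcs by (intro card_subset_eq) auto
  ultimately show ?thesis using triangle d by blast
qed

end
section \<open>Contracting a perfect matching of a bipartite graph\<close>

text \<open>The colour classes are named because \<open>A\<close> will be the vertex set of the
  contracted digraph.\<close>

definition bipartition :: "('v, 'e) mgraph \<Rightarrow> 'v set \<Rightarrow> 'v set \<Rightarrow> bool" where
  "bipartition G A B \<longleftrightarrow> A \<union> B = verts G \<and> A \<inter> B = {} \<and>
     (\<forall>e\<in>edges G. \<exists>a\<in>A. \<exists>b\<in>B. ends G e = {a, b})"

text \<open>Edges turn into ordered pairs, and parallel edges are merged.\<close>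

definition incident :: "('v, 'e) mgraph \<Rightarrow> 'v set \<Rightarrow> 'v set \<Rightarrow> ('v \<times> 'v) set" where
  "incident G A B = {(a, b). a \<in> A \<and> b \<in> B \<and> (\<exists>e\<in>edges G. ends G e = {a, b})}"

definition matching_map :: "'v set \<Rightarrow> 'v set \<Rightarrow> ('v \<times> 'v) set \<Rightarrow> ('v \<Rightarrow> 'v) \<Rightarrow> bool" where
  "matching_map A B S \<mu> \<longleftrightarrow> bij_betw \<mu> A B \<and> (\<forall>a\<in>A. (a, \<mu> a) \<in> S)"

text \<open>A vertex \<open>x\<close> stands for the contracted matching edge from \<open>x\<close>
  to \<open>\<mu> x\<close>; the remaining edges are directed from \<open>A\<close> to
  \<open>B\<close>.\<close>

definition contraction :: "'v set \<Rightarrow> ('v \<times> 'v) set \<Rightarrow> ('v \<Rightarrow> 'v) \<Rightarrow> ('v \<times> 'v) set" where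
  "contraction A S \<mu> = {(x, y). x \<in> A \<and> y \<in> A \<and> x \<noteq> y \<and> (x, \<mu> y) \<in> S}"

lemma bipartite_iff: "bipartite G \<longleftrightarrow> (\<exists>A B. bipartition G A B)"
  by (simp add: bipartite_def bipartition_def)

lemma contraction_subset: "contraction A S \<mu> \<subseteq> A \<times> A"
  by (auto simp: contraction_def)

text \<open>Let \<open>b = \<mu> c\<close>. A path from \<open>c\<close> to \<open>a\<close>, closed
  by the edge from \<open>a\<close> to \<open>b\<close>, corresponds to an alternating cycle;
  switching \<open>\<mu>\<close> along it gives the desired matching.\<close>

lemma matching_map_through:
  assumes "finite A" "matching_map A B S \<mu>" "strong_on A (contraction A S \<mu>)"
    and ab: "(a, b) \<in> S" "a \<in> A" "b \<in> B"
  obtains \<nu> where "matching_map A B S \<nu>" "\<nu> a = b"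
proof -
  let ?D = "contraction A S \<mu>"
  have \<mu>: "bij_betw \<mu> A B" "\<And>x. x \<in> A \<Longrightarrow> (x, \<mu> x) \<in> S"
    using assms(2) by (auto simp: matching_map_def)
  obtain c where c: "c \<in> A" "\<mu> c = b"
    using ab(3) \<mu>(1) by (auto simp: bij_betw_def)
  obtain xs where xs: "xs \<noteq> []" "distinct xs" "hd xs = c" "last xs = a"
    "successively (\<lambda>x y. (x, y) \<in> ?D) xs" "set xs \<subseteq> insert c (Range ?D)"
    using distinct_path[OF strong_onD[OF assms(3) c(1) ab(2)]] by blast
  have "set xs \<subseteq> A" using xs(6) c(1) contraction_subset[of A S \<mu>] by blast
  \<comment> \<open>The reflexive closure admits the fixed points of the rotation, where
    \<open>\<mu>\<close> is kept.\<close>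
  moreover have "successively (\<lambda>x y. (x, y) \<in> ?D\<^sup>=) xs"
    using xs(5) by (rule successively_mono) auto
  ultimately obtain p where p: "bij_betw p A A" "p a = c" "\<forall>x\<in>A - {a}. (x, p x) \<in> ?D\<^sup>="
    using cycle_permutation[OF assms(1) xs(2,1), of "?D\<^sup>="] xs(3,4) by auto
  have "bij_betw (\<mu> \<circ> p) A B" using p(1) \<mu>(1) by (rule bij_betw_trans)
  moreover have "(x, (\<mu> \<circ> p) x) \<in> S" if "x \<in> A" for x
  proof (cases "x = a")
    case True
    then show ?thesis using p(2) c(2) ab(1) by simp
  next
    case False
    then have "(x, p x) \<in> ?D\<^sup>=" using p(3) that by blast
    then show ?thesis using \<mu>(2)[OF that] by (auto simp: contraction_def)
  qed
  ultimately have "matching_map A B S (\<mu> \<circ> p)" by (simp add: matching_map_def)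
  then show ?thesis using that[of "\<mu> \<circ> p"] p(2) c(2) by simp
qed

lemma perfect_matching_of_map:
  assumes bip: "bipartition G A B" and \<nu>: "matching_map A B (incident G A B) \<nu>"
    and e: "e \<in> edges G" "ends G e = {a, \<nu> a}" "a \<in> A"
  shows "\<exists>M. perfect_matching G M \<and> e \<in> M"
proof -
  have bij: "bij_betw \<nu> A B" using \<nu> by (simp add: matching_map_def)
  have AB: "A \<union> B = verts G" "A \<inter> B = {}" using bip by (auto simp: bipartition_def)
  have \<nu>B: "\<nu> x \<in> B" if "x \<in> A" for x using bij that by (auto simp: bij_betw_def)
  have "\<forall>x\<in>A. \<exists>f. f \<in> edges G \<and> ends G f = {x, \<nu> x}"
    using \<nu> by (auto simp: matching_map_def incident_def)
  then obtain h0 where h0: "\<forall>x\<in>A. h0 x \<in> edges G \<and> ends G (h0 x) = {x, \<nu> x}"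
    by (rule bchoice[THEN exE])
  \<comment> \<open>At \<open>a\<close> the given \<open>e\<close> is chosen among its parallel
    edges.\<close>
  define h where "h = h0(a := e)"
  have h: "h x \<in> edges G" "ends G (h x) = {x, \<nu> x}" if "x \<in> A" for x
    using h0 e that by (auto simp: h_def)
  have "\<exists>!f. f \<in> h ` A \<and> v \<in> ends G f" if v: "v \<in> verts G" for v
  proof -
    obtain x where x: "x \<in> A" "v = x \<or> v = \<nu> x"
      using v AB(1) bij by (auto simp: bij_betw_def)
    have "x' = x" if "x' \<in> A" "v \<in> {x', \<nu> x'}" for x'
      using that x \<nu>B[OF that(1)] \<nu>B[OF x(1)] AB(2) bij
      by (auto simp: bij_betw_def dest: inj_onD)
    then have "f = h x" if "f \<in> h ` A" "v \<in> ends G f" for f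
      using that h(2) by (metis imageE)
    moreover have "h x \<in> h ` A" "v \<in> ends G (h x)" using x h(2) by auto
    ultimately show ?thesis by (intro ex1I[of _ "h x"]) blast+
  qed
  then have "perfect_matching G (h ` A)" using h(1) by (auto simp: perfect_matching_def)
  moreover have "e \<in> h ` A" using e(3) by (auto simp: h_def image_iff)
  ultimately show ?thesis by blast
qed

text \<open>An arc from \<open>x\<close> to \<open>y\<close> lifts to the walk \<open>x\<close>,
  \<open>\<mu> y\<close>, \<open>y\<close>, so strong connectedness yields connectedness;
  \<open>matching_map_through\<close> supplies the perfect matchings.\<close>

lemma matching_coveredI:
  assumes bip: "bipartition G A B" and G: "multigraph G" "4 \<le> card (verts G)"
    and \<mu>: "matching_map A B (incident G A B) \<mu>"
    and strong: "strong_on A (contraction A (incident G A B) \<mu>)"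
  shows "matching_covered G"
proof -
  let ?S = "incident G A B" and ?R = "adjacency G"
  have AB: "A \<union> B = verts G" using bip by (auto simp: bipartition_def)
  have fin: "finite A" using AB G(1) by (metis finite_Un multigraph_def)
  have bij: "bij_betw \<mu> A B" using \<mu> by (simp add: matching_map_def)
  have adj: "(x, y) \<in> ?R" "(y, x) \<in> ?R" if "(x, y) \<in> ?S" for x y
    using that by (auto simp: incident_def adjacency_def insert_commute)
  have mate: "(x, \<mu> x) \<in> ?R" "(\<mu> x, x) \<in> ?R" if "x \<in> A" for x
    using adj \<mu> that by (auto simp: matching_map_def)
  have "contraction A ?S \<mu> \<subseteq> ?R\<^sup>*"
  proof (rule subrelI)
    fix x y assume "(x, y) \<in> contraction A ?S \<mu>"
    then have "(x, \<mu> y) \<in> ?R" "(\<mu> y, y) \<in> ?R" using adj mate by (auto simp: contraction_def)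
    then show "(x, y) \<in> ?R\<^sup>*" by (meson r_into_rtrancl rtrancl_into_rtrancl)
  qed
  then have "(contraction A ?S \<mu>)\<^sup>* \<subseteq> ?R\<^sup>*" by (rule rtrancl_subset_rtrancl)
  then have A: "(x, y) \<in> ?R\<^sup>*" if "x \<in> A" "y \<in> A" for x y
    using strong_onD[OF strong that] by blast
  have near: "\<exists>x\<in>A. (v, x) \<in> ?R\<^sup>* \<and> (x, v) \<in> ?R\<^sup>*" if v: "v \<in> verts G" for v
  proof (cases "v \<in> A")
    case True
    then show ?thesis by blast
  next
    case False
    then obtain x where "x \<in> A" "v = \<mu> x" using v AB bij by (auto simp: bij_betw_def)
    then show ?thesis using mate[of x] by blast
  qed
  have "(u, v) \<in> ?R\<^sup>*" if u: "u \<in> verts G" and v: "v \<in> verts G" for u v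
  proof -
    obtain x y where "x \<in> A" "(u, x) \<in> ?R\<^sup>*" "y \<in> A" "(y, v) \<in> ?R\<^sup>*"
      using near[OF u] near[OF v] by blast
    then show ?thesis using A[of x y] by (meson rtrancl_trans)
  qed
  then have "connected_graph G" using G(2) by (auto simp: connected_graph_def)
  moreover have "\<exists>M. perfect_matching G M \<and> e \<in> M" if e: "e \<in> edges G" for e
  proof -
    obtain a b where ab: "a \<in> A" "b \<in> B" "ends G e = {a, b}"
      using bip e by (auto simp: bipartition_def)
    then have "(a, b) \<in> ?S" using e by (auto simp: incident_def)
    then obtain \<nu> where "matching_map A B ?S \<nu>" "\<nu> a = b"
      using matching_map_through[OF fin \<mu> strong _ ab(1,2)] by blast
    then show ?thesis using perfect_matching_of_map[OF bip _ e] ab by auto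
  qed
  ultimately show ?thesis using G by (auto simp: matching_covered_def)
qed

lemma matching_map_of_edge:
  assumes bip: "bipartition G A B" and G: "matching_covered G" and ab: "(a, b) \<in> incident G A B"
  obtains \<mu> where "matching_map A B (incident G A B) \<mu>" "\<mu> a = b"
proof -
  have AB: "A \<union> B = verts G" "A \<inter> B = {}" using bip by (auto simp: bipartition_def)
  obtain e where e: "e \<in> edges G" "ends G e = {a, b}" "a \<in> A" "b \<in> B"
    using ab by (auto simp: incident_def)
  then obtain M where M: "perfect_matching G M" "e \<in> M"
    using G by (auto simp: matching_covered_def)
  have uniq: "f = f'" if "f \<in> M" "f' \<in> M" "v \<in> ends G f" "v \<in> ends G f'" "v \<in> verts G" for f f' v
    using M(1) that by (auto simp: perfect_matching_def)
  have edge: "\<exists>f x y. f \<in> M \<and> x \<in> A \<and> y \<in> B \<and> ends G f = {x, y} \<and> v \<in> {x, y}"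
    if v: "v \<in> verts G" for v
  proof -
    obtain f where f: "f \<in> M" "v \<in> ends G f" using M(1) v by (auto simp: perfect_matching_def)
    then have "f \<in> edges G" using M(1) by (auto simp: perfect_matching_def)
    then show ?thesis using f bip unfolding bipartition_def by metis
  qed
  have "\<forall>x\<in>A. \<exists>y. y \<in> B \<and> (\<exists>f\<in>M. ends G f = {x, y})"
  proof
    fix x assume x: "x \<in> A"
    then obtain f x' y where "f \<in> M" "x' \<in> A" "y \<in> B" "ends G f = {x', y}" "x \<in> {x', y}"
      using edge[of x] AB by blast
    then show "\<exists>y. y \<in> B \<and> (\<exists>f\<in>M. ends G f = {x, y})" using x AB(2) by blast
  qed
  then obtain \<mu> where \<mu>: "\<forall>x\<in>A. \<mu> x \<in> B \<and> (\<exists>f\<in>M. ends G f = {x, \<mu> x})"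
    by (rule bchoice[THEN exE])
  \<comment> \<open>Two edges of a perfect matching with a common end coincide, so partners
    determine each other.\<close>
  have det: "x = x' \<longleftrightarrow> y = y'"
    if "f \<in> M" "f' \<in> M" "ends G f = {x, y}" "ends G f' = {x', y'}" "x \<in> A" "x' \<in> A" "y \<in> B" "y' \<in> B"
    for f f' x x' y y'
  proof -
    have "f = f'" if "x = x' \<or> y = y'"
      using uniq[OF \<open>f \<in> M\<close> \<open>f' \<in> M\<close>, of x] uniq[OF \<open>f \<in> M\<close> \<open>f' \<in> M\<close>, of y] that
        \<open>ends G f = {x, y}\<close> \<open>ends G f' = {x', y'}\<close> \<open>x \<in> A\<close> \<open>y \<in> B\<close> AB(1) by blast
    then show ?thesis
      using that AB(2) by (metis IntI doubleton_eq_iff empty_iff)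
  qed
  have "inj_on \<mu> A"
    using \<mu> det by (intro inj_onI) metis
  moreover have "y \<in> \<mu> ` A" if y: "y \<in> B" for y
  proof -
    obtain f x y' where f: "f \<in> M" "x \<in> A" "y' \<in> B" "ends G f = {x, y'}" "y \<in> {x, y'}"
      using edge[of y] AB y by blast
    then have "y = y'" using AB(2) y by blast
    then have "y = \<mu> x" using \<mu> det f by metis
    then show ?thesis using f(2) by blast
  qed
  ultimately have "bij_betw \<mu> A B" using \<mu> by (auto simp: bij_betw_def)
  moreover have "(x, \<mu> x) \<in> incident G A B" if x: "x \<in> A" for x
  proof -
    obtain f where "f \<in> M" "ends G f = {x, \<mu> x}" "\<mu> x \<in> B" using \<mu> x by blast
    moreover have "M \<subseteq> edges G" using M(1) by (simp add: perfect_matching_def)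
    ultimately show ?thesis using x by (auto simp: incident_def)
  qed
  moreover have "\<mu> a = b" using \<mu> det e M(2) by metis
  ultimately show ?thesis using that by (auto simp: matching_map_def)
qed

text \<open>A proper closed set \<open>X\<close> has all its neighbours in its image under
  \<open>\<mu>\<close>, so by counting every perfect matching maps \<open>X\<close> onto that image.
  An edge from the image to a vertex outside \<open>X\<close>, which exists by connectedness, then
  lies in no perfect matching.\<close>

lemma contraction_strong:
  assumes bip: "bipartition G A B" and G: "matching_covered G"
    and \<mu>: "matching_map A B (incident G A B) \<mu>"
  shows "strong_on A (contraction A (incident G A B) \<mu>)"
proof (rule ccontr)
  let ?S = "incident G A B"
  assume "\<not> ?thesis"
  from not_strong_closed[OF this contraction_subset] obtain X where
    X: "X \<subseteq> A" "X \<noteq> {}" "X \<noteq> A" "contraction A ?S \<mu> `` X \<subseteq> X" .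
  have AB: "A \<union> B = verts G" "A \<inter> B = {}" using bip by (auto simp: bipartition_def)
  have "finite (verts G)" using G by (auto simp: matching_covered_def multigraph_def)
  then have finX: "finite X" using X(1) AB(1) by (metis finite_Un finite_subset)
  have bij: "bij_betw \<mu> A B" using \<mu> by (simp add: matching_map_def)
  have closed: "b \<in> \<mu> ` X" if x: "x \<in> X" and xb: "(x, b) \<in> ?S" for x b
  proof -
    obtain y where y: "y \<in> A" "b = \<mu> y" using xb bij by (auto simp: incident_def bij_betw_def)
    then have "x = y \<or> (x, y) \<in> contraction A ?S \<mu>"
      using x xb X(1) by (auto simp: contraction_def)
    then show ?thesis using X(4) x y(2) by blast
  qed
  have \<mu>X: "\<mu> ` X \<subseteq> B" using X(1) bij by (auto simp: bij_betw_def)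
  obtain x y where "x \<in> X" "y \<in> A" "y \<notin> X" using X by blast
  moreover have "(x, y) \<in> (adjacency G)\<^sup>*"
  proof -
    have "x \<in> verts G" "y \<in> verts G" using calculation X(1) AB(1) by blast+
    then show ?thesis using G by (simp add: matching_covered_def connected_graph_def)
  qed
  ultimately obtain p q where pq: "(p, q) \<in> adjacency G" "p \<in> X \<union> \<mu> ` X" "q \<notin> X \<union> \<mu> ` X"
    using rtrancl_leaves[of x y "adjacency G" "X \<union> \<mu> ` X"] \<mu>X AB(2) by blast
  then obtain e where e: "e \<in> edges G" "ends G e = {p, q}" by (auto simp: adjacency_def)
  then obtain a b where ab: "a \<in> A" "b \<in> B" "{p, q} = {a, b}" using bip by (metis bipartition_def)
  then have S: "(a, b) \<in> ?S" using e by (auto simp: incident_def)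
  \<comment> \<open>The edge does not leave from \<open>X\<close> itself, whose neighbours are all
    inside; so it leaves from \<open>b\<close> in the image and ends at \<open>a\<close> outside
    \<open>X\<close>.\<close>
  have "\<not> (p = a \<and> q = b)"
    using closed[OF _ S] pq(2,3) \<mu>X ab AB(2) by blast
  then have pq': "p = b" "q = a" using ab(3) by (auto simp: doubleton_eq_iff)
  obtain \<nu> where \<nu>: "matching_map A B ?S \<nu>" "\<nu> a = b" using matching_map_of_edge[OF bip G S] .
  have inj: "inj_on \<nu> A" "inj_on \<mu> A" using \<nu>(1) bij by (auto simp: matching_map_def bij_betw_def)
  have "\<nu> ` X \<subseteq> \<mu> ` X" using closed \<nu>(1) X(1) by (auto simp: matching_map_def)
  moreover have "card (\<nu> ` X) = card (\<mu> ` X)"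
    using inj X(1) by (simp add: card_image inj_on_subset)
  ultimately have "\<nu> ` X = \<mu> ` X" using finX by (simp add: card_subset_eq)
  moreover have "b \<in> \<mu> ` X" using pq(2) pq' X(1) AB(2) ab(2) by blast
  ultimately have "\<nu> a \<in> \<nu> ` X" using \<nu>(2) by simp
  then obtain x where "x \<in> X" "\<nu> x = \<nu> a" by (metis imageE)
  then have "x = a" using inj_onD[OF inj(1)] X(1) ab(1) by blast
  then show False using \<open>x \<in> X\<close> pq(3) pq' by blast
qed

section \<open>Minimality and deletion of edges\<close>

lemma bipartition_delete_edge: "bipartition G A B \<Longrightarrow> bipartition (delete_edge G e) A B"
  by (auto simp: bipartition_def delete_edge_def)

lemma multigraph_delete_edge: "multigraph G \<Longrightarrow> multigraph (delete_edge G e)"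
  by (auto simp: multigraph_def delete_edge_def)

lemma verts_delete_edge [simp]: "verts (delete_edge G e) = verts G"
  by (simp add: delete_edge_def)

text \<open>\<open>card_edges\<close> is edge extremality cleared of its denominator.\<close>

locale extremal_bipartite =
  fixes G :: "('v, 'e) mgraph" and A B :: "'v set"
  assumes minimal: "minimal_matching_covered G" and bip: "bipartition G A B"
    and card_edges: "2 * card (edges G) + 6 = 3 * card (verts G)"
begin

abbreviation "S \<equiv> incident G A B"

lemma mc: "matching_covered G" and mg: "multigraph G" and card_verts: "4 \<le> card (verts G)"
  using minimal by (auto simp: minimal_matching_covered_def matching_covered_def)

lemma AB: "A \<union> B = verts G" "A \<inter> B = {}" "finite A" "finite B" "finite (edges G)"
proof -
  show u: "A \<union> B = verts G" "A \<inter> B = {}" using bip by (auto simp: bipartition_def)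
  have "finite (A \<union> B)" "finite (edges G)" using mg u(1) by (auto simp: multigraph_def)
  then show "finite A" "finite B" "finite (edges G)" by auto
qed

lemma edge_ends:
  assumes "e \<in> edges G"
  obtains a b where "a \<in> A" "b \<in> B" "ends G e = {a, b}" "(a, b) \<in> S"
proof -
  obtain a b where "a \<in> A" "b \<in> B" "ends G e = {a, b}"
    using assms bip by (auto simp: bipartition_def)
  moreover from this have "(a, b) \<in> S" using assms by (auto simp: incident_def)
  ultimately show ?thesis using that by blast
qed

lemma edge_indispensable:
  assumes "e \<in> edges G" "matching_map A B (incident (delete_edge G e) A B) \<mu>"
  shows "\<not> strong_on A (contraction A (incident (delete_edge G e) A B) \<mu>)"
  using matching_coveredI[OF bipartition_delete_edge[OF bip] multigraph_delete_edge[OF mg] _ assms(2)]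
    assms(1) card_verts minimal by (auto simp: minimal_matching_covered_def)

text \<open>Deleting one of two parallel edges does not change \<open>incident\<close>, so the graph
  would remain matching covered.\<close>

lemma inj_ends: "inj_on (ends G) (edges G)"
proof (rule inj_onI, rule ccontr)
  fix e f assume ef: "e \<in> edges G" "f \<in> edges G" "ends G e = ends G f" "e \<noteq> f"
  then have S: "incident (delete_edge G e) A B = S"
    by (auto simp: incident_def delete_edge_def)
  obtain a b where "(a, b) \<in> S" using edge_ends[OF ef(1)] .
  then obtain \<mu> where \<mu>: "matching_map A B S \<mu>" using matching_map_of_edge[OF bip mc] by metis
  show False
    using edge_indispensable[OF ef(1), of \<mu>] \<mu> contraction_strong[OF bip mc \<mu>] by (simp add: S)
qed

text \<open>In the absence of parallel edges, deleting an edge removes exactly one pair from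
  \<open>S\<close>.\<close>

lemma pair_indispensable:
  assumes ab: "(a, b) \<in> S" and "matching_map A B (S - {(a, b)}) \<mu>"
  shows "\<not> strong_on A (contraction A (S - {(a, b)}) \<mu>)"
proof -
  obtain e where e: "e \<in> edges G" "ends G e = {a, b}" "a \<in> A" "b \<in> B"
    using ab by (auto simp: incident_def)
  have "incident (delete_edge G e) A B = S - {(a, b)}"
  proof (intro equalityI subrelI)
    fix x y assume "(x, y) \<in> incident (delete_edge G e) A B"
    then obtain f where f: "f \<in> edges G" "f \<noteq> e" "ends G f = {x, y}" "x \<in> A" "y \<in> B"
      by (auto simp: incident_def delete_edge_def)
    then have "(x, y) \<noteq> (a, b)" using inj_onD[OF inj_ends, of f e] e by auto
    then show "(x, y) \<in> S - {(a, b)}" using f by (auto simp: incident_def)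
  next
    fix x y assume xy: "(x, y) \<in> S - {(a, b)}"
    then obtain f where f: "f \<in> edges G" "ends G f = {x, y}" "x \<in> A" "y \<in> B"
      by (auto simp: incident_def)
    then have "ends G f \<noteq> ends G e" using xy e AB(2) by (auto simp: doubleton_eq_iff)
    then show "(x, y) \<in> incident (delete_edge G e) A B"
      using f by (auto simp: incident_def delete_edge_def)
  qed
  then show ?thesis using edge_indispensable[OF e(1), of \<mu>] assms(2) by simp
qed

lemma edges_bij:
  obtains \<phi> where "bij_betw \<phi> (edges G) S" "\<And>e. e \<in> edges G \<Longrightarrow> ends G e = {fst (\<phi> e), snd (\<phi> e)}"
proof -
  have "\<forall>e\<in>edges G. \<exists>s. s \<in> S \<and> ends G e = {fst s, snd s}"
    using edge_ends by (metis fst_conv snd_conv)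
  then obtain \<phi> where \<phi>: "\<forall>e\<in>edges G. \<phi> e \<in> S \<and> ends G e = {fst (\<phi> e), snd (\<phi> e)}"
    by (rule bchoice[THEN exE])
  have "inj_on \<phi> (edges G)"
    using \<phi> inj_onD[OF inj_ends] by (intro inj_onI) metis
  moreover have "s \<in> \<phi> ` edges G" if s: "s \<in> S" for s
  proof -
    obtain a b where ab: "s = (a, b)" by (cases s)
    obtain e where e: "e \<in> edges G" "ends G e = {a, b}" "a \<in> A" "b \<in> B"
      using s ab by (auto simp: incident_def)
    then have "{fst (\<phi> e), snd (\<phi> e)} = {a, b}" "fst (\<phi> e) \<in> A" "snd (\<phi> e) \<in> B"
      using \<phi> by (auto simp: incident_def)
    then have "\<phi> e = (a, b)" using e AB(2) by (auto simp: doubleton_eq_iff prod_eq_iff)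
    then show ?thesis using e(1) ab by (metis image_eqI)
  qed
  ultimately have "bij_betw \<phi> (edges G) S" using \<phi> by (auto simp: bij_betw_def)
  then show ?thesis using that \<phi> by blast
qed

lemma card_incident: "card S = card (edges G)"
  using edges_bij bij_betw_same_card by metis

lemma degree_left: assumes a: "a \<in> A" shows "degree G a = card (S `` {a})"
proof -
  obtain \<phi> where \<phi>: "bij_betw \<phi> (edges G) S"
    "\<And>e. e \<in> edges G \<Longrightarrow> ends G e = {fst (\<phi> e), snd (\<phi> e)}"
    using edges_bij by blast
  have mem: "\<phi> e \<in> S" if "e \<in> edges G" for e using \<phi>(1) that by (auto simp: bij_betw_def)
  have *: "a \<in> ends G e \<longleftrightarrow> fst (\<phi> e) = a" if e: "e \<in> edges G" for e
    using \<phi>(2)[OF e] mem[OF e] a AB(2) by (auto simp: incident_def)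
  have "bij_betw \<phi> {e \<in> edges G. a \<in> ends G e} ({a} \<times> S `` {a})"
  proof (rule bij_betw_subset[OF \<phi>(1)])
    have "S = \<phi> ` edges G" using \<phi>(1) by (simp add: bij_betw_def)
    then have "{s \<in> S. fst s = a} = \<phi> ` {e \<in> edges G. a \<in> ends G e}" using * by auto
    moreover have "{s \<in> S. fst s = a} = {a} \<times> S `` {a}" by auto
    ultimately show "\<phi> ` {e \<in> edges G. a \<in> ends G e} = {a} \<times> S `` {a}" by simp
  qed auto
  then show ?thesis
    unfolding degree_def by (simp add: bij_betw_same_card card_cartesian_product_singleton)
qed

lemma degree_right: assumes b: "b \<in> B" shows "degree G b = card (S\<inverse> `` {b})"
proof -
  obtain \<phi> where \<phi>: "bij_betw \<phi> (edges G) S"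
    "\<And>e. e \<in> edges G \<Longrightarrow> ends G e = {fst (\<phi> e), snd (\<phi> e)}"
    using edges_bij by blast
  have mem: "\<phi> e \<in> S" if "e \<in> edges G" for e using \<phi>(1) that by (auto simp: bij_betw_def)
  have *: "b \<in> ends G e \<longleftrightarrow> snd (\<phi> e) = b" if e: "e \<in> edges G" for e
    using \<phi>(2)[OF e] mem[OF e] b AB(2) by (auto simp: incident_def)
  have "bij_betw \<phi> {e \<in> edges G. b \<in> ends G e} (S\<inverse> `` {b} \<times> {b})"
  proof (rule bij_betw_subset[OF \<phi>(1)])
    have "S = \<phi> ` edges G" using \<phi>(1) by (simp add: bij_betw_def)
    then have "{s \<in> S. snd s = b} = \<phi> ` {e \<in> edges G. b \<in> ends G e}" using * by auto
    moreover have "{s \<in> S. snd s = b} = S\<inverse> `` {b} \<times> {b}" by auto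
    ultimately show "\<phi> ` {e \<in> edges G. b \<in> ends G e} = S\<inverse> `` {b} \<times> {b}" by simp
  qed auto
  then show ?thesis
    unfolding degree_def by (simp add: bij_betw_same_card card_cartesian_product)
qed

section \<open>The contraction of an extremal graph\<close>

context
  fixes \<mu> assumes \<mu>: "matching_map A B S \<mu>"
begin

abbreviation "D \<equiv> contraction A S \<mu>"

lemma \<mu>_bij: "bij_betw \<mu> A B" and \<mu>_inj: "inj_on \<mu> A" and \<mu>_img: "\<mu> ` A = B"
  using \<mu> by (auto simp: matching_map_def bij_betw_def)

lemma \<mu>_eq: "x \<in> A \<Longrightarrow> y \<in> A \<Longrightarrow> \<mu> x = \<mu> y \<longleftrightarrow> x = y"
  using \<mu>_inj by (auto simp: inj_on_def)

lemma incident_iff: "x \<in> A \<Longrightarrow> y \<in> A \<Longrightarrow> (x, \<mu> y) \<in> S \<longleftrightarrow> x = y \<or> (x, y) \<in> D"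
  using \<mu> by (auto simp: matching_map_def contraction_def)

text \<open>The matching edge accounts for the extra one. The other edges at \<open>a\<close> are
  the arcs leaving \<open>a\<close>; those at \<open>\<mu> a\<close> will be the arcs entering
  it.\<close>

lemma degree_left_contraction: assumes a: "a \<in> A" shows "degree G a = Suc (card (D `` {a}))"
proof -
  have "S `` {a} \<subseteq> \<mu> ` A" using \<mu>_img by (auto simp: incident_def)
  then have "S `` {a} = \<mu> ` {y \<in> A. (a, \<mu> y) \<in> S}" by auto
  also have "{y \<in> A. (a, \<mu> y) \<in> S} = insert a (D `` {a})"
    using a incident_iff[OF a] by (auto simp: contraction_def)
  finally have "card (S `` {a}) = card (insert a (D `` {a}))"
    using card_image[OF inj_on_subset[OF \<mu>_inj, of "insert a (D `` {a})"]] a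
    by (auto simp: contraction_def)
  moreover have "finite (D `` {a})" using AB(3) by (rule rev_finite_subset) (auto simp: contraction_def)
  moreover have "a \<notin> D `` {a}" by (auto simp: contraction_def)
  ultimately show ?thesis using degree_left[OF a] by simp
qed

lemma degree_right_contraction: assumes a: "a \<in> A" shows "degree G (\<mu> a) = Suc (card (D\<inverse> `` {a}))"
proof -
  have "S\<inverse> `` {\<mu> a} = insert a (D\<inverse> `` {a})"
    using a incident_iff[OF _ a] by (auto simp: incident_def contraction_def)
  moreover have "finite (D\<inverse> `` {a})" using AB(3) by (rule rev_finite_subset) (auto simp: contraction_def)
  moreover have "a \<notin> D\<inverse> `` {a}" by (auto simp: contraction_def)
  moreover have "\<mu> a \<in> B" using a \<mu>_img by auto
  ultimately show ?thesis using degree_right[of "\<mu> a"] by simp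
qed

lemma card_A: "card (verts G) = 2 * card A"
  using card_Un_disjoint[OF AB(3,4,2)] AB(1) bij_betw_same_card[OF \<mu>_bij] by simp

text \<open>With N = \<open>card A\<close> there are 3N - 3 edges; N of them are matching edges and
  2N - 3 become arcs.\<close>

lemma card_contraction: "card D + 3 = 2 * card A"
proof -
  \<comment> \<open>The loops in \<open>?R\<close> stand for the matching edges.\<close>
  let ?R = "D \<union> (\<lambda>x. (x, x)) ` A"
  have inj: "inj_on (\<lambda>(x, y). (x, \<mu> y)) (A \<times> A)"
    using \<mu>_eq by (auto intro!: inj_onI)
  have R: "?R \<subseteq> A \<times> A" by (auto simp: contraction_def)
  have "S = (\<lambda>(x, y). (x, \<mu> y)) ` ?R"
  proof (intro equalityI subrelI)
    fix x b assume xb: "(x, b) \<in> S"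
    then obtain y where "x \<in> A" "y \<in> A" "b = \<mu> y" using \<mu>_img by (auto simp: incident_def)
    then have "(x, y) \<in> ?R" using xb incident_iff by auto
    then show "(x, b) \<in> (\<lambda>(x, y). (x, \<mu> y)) ` ?R" using \<open>b = \<mu> y\<close> by force
  next
    fix x b assume "(x, b) \<in> (\<lambda>(x, y). (x, \<mu> y)) ` ?R"
    then obtain y where y: "(x, y) \<in> ?R" "b = \<mu> y" by auto
    then have "x \<in> A" "y \<in> A" using R by auto
    then show "(x, b) \<in> S" using y incident_iff[of x y] by auto
  qed
  then have "card S = card ?R" using card_image[OF inj_on_subset[OF inj R]] by simp
  also have "\<dots> = card D + card ((\<lambda>x. (x, x)) ` A)"
  proof (rule card_Un_disjoint)
    show "finite D" using AB(3) contraction_subset by (metis finite_SigmaI finite_subset)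
    show "D \<inter> (\<lambda>x. (x, x)) ` A = {}" by (auto simp: contraction_def)
  qed (use AB(3) in auto)
  also have "card ((\<lambda>x. (x, x)) ` A) = card A" by (simp add: card_image inj_on_def)
  finally show ?thesis using card_incident card_edges card_A by simp
qed

text \<open>The edge behind an arc is not a matching edge, so \<open>\<mu>\<close> survives its
  deletion.\<close>

lemma contraction_minimal:
  assumes "d \<in> D" shows "\<not> strong_on A (D - {d})"
proof -
  obtain x y where d: "d = (x, y)" by (cases d)
  then have xy: "x \<in> A" "y \<in> A" "x \<noteq> y" "(x, \<mu> y) \<in> S" using assms by (auto simp: contraction_def)
  have "matching_map A B (S - {(x, \<mu> y)}) \<mu>"
    using \<mu> xy \<mu>_eq by (auto simp: matching_map_def)
  moreover have "contraction A (S - {(x, \<mu> y)}) \<mu> = D - {(x, y)}"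
    using xy \<mu>_eq by (auto simp: contraction_def)
  ultimately show ?thesis using pair_indispensable[OF xy(4), of \<mu>] d by simp
qed

text \<open>Switch to a perfect matching \<open>\<nu>\<close> that avoids the edge from \<open>v\<close> to \<open>\<mu> v\<close>. As deleting this
  edge destroys strong connectedness, some proper vertex set has no more neighbours than elements,
  which is only possible if the deletion lost the neighbour \<open>\<mu> v\<close>.\<close>

lemma contraction_separation:
  assumes v: "v \<in> A" shows "\<exists>X z. v \<in> X \<and> z \<notin> X \<and> D `` X \<subseteq> insert z (X - {v})"
proof -
  have strong: "strong_on A D" by (rule contraction_strong[OF bip mc \<mu>])
  have vv: "(v, \<mu> v) \<in> S" using \<mu> v by (auto simp: matching_map_def)
  have "A \<noteq> {v}" using card_A card_verts by auto
  then have "\<not> D `` {v} \<subseteq> {v}" using closed_imp_all[OF strong, of "{v}"] v by auto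
  \<comment> \<open>A second neighbour \<open>\<mu> w\<close> of \<open>v\<close> provides the
    matching that avoids \<open>\<mu> v\<close>.\<close>
  then obtain w where w: "(v, w) \<in> D" "w \<noteq> v" by auto
  then have "(v, \<mu> w) \<in> S" "w \<in> A" by (auto simp: contraction_def)
  then obtain \<nu> where \<nu>: "matching_map A B S \<nu>" "\<nu> v = \<mu> w"
    using matching_map_of_edge[OF bip mc] by metis
  let ?S' = "S - {(v, \<mu> v)}"
  have \<nu>': "matching_map A B ?S' \<nu>"
    using \<nu> v \<open>w \<in> A\<close> w(2) \<mu>_eq by (auto simp: matching_map_def)
  from not_strong_closed[OF pair_indispensable[OF vv \<nu>'] contraction_subset] obtain X where
    X: "X \<subseteq> A" "X \<noteq> {}" "X \<noteq> A" "contraction A ?S' \<nu> `` X \<subseteq> X" .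
  have finX: "finite X" using X(1) AB(3) by (rule finite_subset)
  have closed: "b \<in> \<nu> ` X" if x: "x \<in> X" and xb: "(x, b) \<in> ?S'" for x b
  proof -
    obtain y where y: "y \<in> A" "b = \<nu> y"
      using xb \<nu>(1) by (auto simp: incident_def matching_map_def bij_betw_def)
    then have "x = y \<or> (x, y) \<in> contraction A ?S' \<nu>"
      using x xb X(1) by (auto simp: contraction_def)
    then show ?thesis using X(4) x y(2) by blast
  qed
  \<comment> \<open>\<open>Y\<close> describes, by their partners under \<open>\<mu>\<close>, the
    neighbours that \<open>X\<close> keeps after the deletion. All of them are images of
    \<open>X\<close> under \<open>\<nu>\<close>, so there are at most \<open>card X\<close>.\<close>
  define Y where "Y = {y \<in> A. \<exists>x\<in>X. (x, \<mu> y) \<in> ?S'}"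
  have "\<mu> ` Y \<subseteq> \<nu> ` X" using closed by (auto simp: Y_def)
  then have "card (\<mu> ` Y) \<le> card (\<nu> ` X)" using finX by (intro card_mono) auto
  moreover have "card (\<mu> ` Y) = card Y"
    by (rule card_image[OF inj_on_subset[OF \<mu>_inj]]) (auto simp: Y_def)
  moreover have "card (\<nu> ` X) \<le> card X" using finX by (rule card_image_le)
  ultimately have cY: "card Y \<le> card X" by linarith
  have finY: "finite Y" using AB(3) by (auto simp: Y_def)
  have XY: "X - {v} \<subseteq> Y"
  proof
    fix x assume x: "x \<in> X - {v}"
    then have "x \<in> A" "(x, \<mu> x) \<in> ?S'" using X(1) \<mu> by (auto simp: matching_map_def)
    then show "x \<in> Y" using x by (auto simp: Y_def)
  qed
  have DY: "D `` X \<subseteq> Y"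
  proof
    fix y assume "y \<in> D `` X"
    then obtain x where x: "x \<in> X" "(x, y) \<in> D" by auto
    then have xy: "x \<in> A" "y \<in> A" "x \<noteq> y" "(x, \<mu> y) \<in> S" by (auto simp: contraction_def)
    then have "(x, \<mu> y) \<in> ?S'" using \<mu>_eq[OF v xy(2)] by auto
    then show "y \<in> Y" using x xy by (auto simp: Y_def)
  qed
  have "\<not> D `` X \<subseteq> X" using closed_imp_all[OF strong X(1,2)] X(3) by blast
  then obtain z where z: "z \<in> D `` X" "z \<notin> X" by blast
  \<comment> \<open>\<open>Y\<close> contains \<open>X - {v}\<close> and the new element
    \<open>z\<close>, yet has at most \<open>card X\<close> elements. This forces
    \<open>v \<in> X\<close> and leaves room for nothing else.\<close>
  have sub: "insert z (X - {v}) \<subseteq> Y" using z DY XY by blast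
  have card': "card (insert z (X - {v})) = Suc (card (X - {v}))" using z finX by simp
  have "v \<in> X"
  proof (rule ccontr)
    assume "v \<notin> X"
    then have "card (insert z (X - {v})) = Suc (card X)" using card' by simp
    then show False using card_mono[OF finY sub] cY by simp
  qed
  then have "card (insert z (X - {v})) = card X"
    using card' finX by (metis card_Suc_Diff1)
  then have "Y = insert z (X - {v})" using sub cY finY card_subset_eq[OF finY sub] card_mono[OF finY sub] by simp
  then show ?thesis using DY z(2) \<open>v \<in> X\<close> by blast
qed

lemma extremal_digraph_contraction: "extremal_digraph A D"
proof
  show "finite A" by (rule AB)
  show "D \<subseteq> A \<times> A" by (rule contraction_subset)
  show "(x, x) \<notin> D" for x by (simp add: contraction_def)
  show "strong_on A D" by (rule contraction_strong[OF bip mc \<mu>])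
qed (fact contraction_minimal card_contraction contraction_separation)+

end

section \<open>Counting the vertices of degree two\<close>

lemma V2_or_cycle: "card (V2 G) + 2 = card (verts G) \<or> isomorphic G (cycle_graph 6)"
proof -
  have "edges G \<noteq> {}" using card_edges card_verts by auto
  then obtain e where "e \<in> edges G" by blast
  then obtain a0 b0 where "(a0, b0) \<in> S" using edge_ends by metis
  then obtain \<mu> where \<mu>: "matching_map A B S \<mu>" using matching_map_of_edge[OF bip mc] by metis
  interpret D: extremal_digraph A "contraction A S \<mu>" by (rule extremal_digraph_contraction[OF \<mu>])
  note \<mu>_eq = \<mu>_eq[OF \<mu>] and \<mu>_img = \<mu>_img[OF \<mu>] and card_A = card_A[OF \<mu>]
  note deg = degree_left_contraction[OF \<mu>] degree_right_contraction[OF \<mu>]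
  have verts: "verts G = A \<union> \<mu> ` A" using AB(1) \<mu>_img by simp
  show ?thesis
  proof (cases rule: D.theta_or_triangle)
    case (theta x y)
    \<comment> \<open>Degree two means a single outgoing arc on the side of \<open>A\<close> and a
      single incoming arc on the other, so only \<open>x\<close> and \<open>\<mu> y\<close> are
      exceptional.\<close>
    have "degree G v = 2 \<longleftrightarrow> v \<noteq> x" if "v \<in> A" for v
      using theta(3) theta(5)[of v] deg(1)[OF that] that by (cases "v = x") auto
    moreover have "degree G (\<mu> v) = 2 \<longleftrightarrow> v \<noteq> y" if "v \<in> A" for v
      using theta(4) theta(6)[of v] deg(2)[OF that] that by (cases "v = y") auto
    ultimately have V2: "V2 G = (A - {x}) \<union> \<mu> ` (A - {y})"
      unfolding V2_def verts by auto
    have "\<mu> ` (A - {y}) \<subseteq> B" using \<mu>_img by auto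
    then have "card (V2 G) = card (A - {x}) + card (\<mu> ` (A - {y}))"
      unfolding V2 using AB(2,3) by (intro card_Un_disjoint) auto
    also have "card (\<mu> ` (A - {y})) = card (A - {y})"
      using \<mu>_eq by (intro card_image inj_onI) auto
    finally have "card (V2 G) = (card A - 1) + (card A - 1)" using theta(1,2) AB(3) by simp
    moreover have "2 \<le> card A" using card_A card_verts by simp
    ultimately have "card (V2 G) + 2 = card (verts G)" using card_A by linarith
    then show ?thesis ..
  next
    case (triangle a b c)
    \<comment> \<open>An arc of the triangle is an edge from its tail to the partner of its head, so
      the graph is the hexagon \<open>a\<close>, \<open>q\<close>, \<open>b\<close>,
      \<open>r\<close>, \<open>c\<close>, \<open>p\<close>.\<close>
    define p q r where pqr: "p = \<mu> a" "q = \<mu> b" "r = \<mu> c"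
    have B: "B = {p, q, r}" using \<mu>_img triangle(2) pqr by auto
    have dist: "distinct [a, b, c, p, q, r]"
      using triangle(1,2) AB(2) B \<mu>_eq pqr by auto
    have V: "verts G = {a, q, b, r, c, p}" using AB(1) B triangle(2) by auto
    have S: "S = {(a, q), (b, q), (b, r), (c, r), (c, p), (a, p)}"
    proof -
      have iff: "(x, \<mu> y) \<in> S \<longleftrightarrow> x = y \<or> (x, y) \<in> {(a, b), (b, c), (c, a)}"
        if "x \<in> A" "y \<in> A" for x y
        using incident_iff[OF \<mu> that] triangle(3) by simp
      have mem: "a \<in> A" "b \<in> A" "c \<in> A" using triangle(2) by auto
      have "(x, z) \<in> {(a, q), (b, q), (b, r), (c, r), (c, p), (a, p)}" if xz: "(x, z) \<in> S" for x z
      proof -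
        obtain y where y: "x \<in> A" "y \<in> A" "z = \<mu> y" using xz \<mu>_img by (auto simp: incident_def)
        then have "x = y \<or> (x, y) \<in> {(a, b), (b, c), (c, a)}" "y \<in> {a, b, c}"
          using iff[of x y] xz triangle(2) by blast+
        then show ?thesis unfolding y(3) pqr by auto
      qed
      moreover have "{(a, q), (b, q), (b, r), (c, r), (c, p), (a, p)} \<subseteq> S"
        unfolding pqr using iff mem by simp
      ultimately show ?thesis by (intro equalityI subrelI) blast+
    qed
    \<comment> \<open>\<open>f\<close> and \<open>h\<close> number the vertices and edges along the
      hexagon as \<open>cycle_graph\<close> does.\<close>
    define f where "f = (\<lambda>v. if v = a then 0 else if v = q then 1 else if v = b then 2
      else if v = r then 3 else if v = c then 4 else (5::nat))"
    define h where "h = (\<lambda>s. if s = (a, q) then 0 else if s = (b, q) then 1 else if s = (b, r) then 2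
      else if s = (c, r) then 3 else if s = (c, p) then 4 else (5::nat))"
    have six: "{..<6::nat} = {0, 1, 2, 3, 4, 5}" by auto
    have f: "bij_betw f (verts G) {..<6}"
      unfolding V six bij_betw_def using dist by (auto simp: f_def inj_on_def)
    have h: "bij_betw h S {..<6}"
      unfolding S six bij_betw_def using dist by (auto simp: h_def inj_on_def)
    have ends: "{h s, Suc (h s) mod 6} = f ` {fst s, snd s}" if "s \<in> S" for s
      using that dist unfolding S by (auto simp: f_def h_def)
    obtain \<phi> where \<phi>: "bij_betw \<phi> (edges G) S"
      "\<And>e. e \<in> edges G \<Longrightarrow> ends G e = {fst (\<phi> e), snd (\<phi> e)}"
      using edges_bij by blast
    have "\<phi> e \<in> S" if "e \<in> edges G" for e using \<phi>(1) that by (auto simp: bij_betw_def)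
    then have "isomorphic G (cycle_graph 6)"
      unfolding isomorphic_def cycle_graph_def
      using f bij_betw_trans[OF \<phi>(1) h] \<phi>(2) ends
      by (intro exI[of _ f] exI[of _ "h \<circ> \<phi>"]) simp
    then show ?thesis by blast
  qed
qed

end

section \<open>Isomorphism classes\<close>

lemma isomorphic_refl: "isomorphic G G"
  unfolding isomorphic_def by (intro exI[of _ id]) auto

lemma isomorphic_trans:
  assumes "isomorphic G H" "isomorphic H K"
  shows "isomorphic G K"
proof -
  obtain f g where fg: "bij_betw f (verts G) (verts H)" "bij_betw g (edges G) (edges H)"
    "\<forall>e\<in>edges G. ends H (g e) = f ` ends G e"
    using assms(1) by (auto simp: isomorphic_def)
  obtain f' g' where fg': "bij_betw f' (verts H) (verts K)" "bij_betw g' (edges H) (edges K)"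
    "\<forall>e\<in>edges H. ends K (g' e) = f' ` ends H e"
    using assms(2) by (auto simp: isomorphic_def)
  have "g e \<in> edges H" if "e \<in> edges G" for e using fg(2) that by (auto simp: bij_betw_def)
  then have "\<forall>e\<in>edges G. ends K ((g' \<circ> g) e) = (f' \<circ> f) ` ends G e"
    using fg(3) fg'(3) by (simp add: image_comp)
  then show ?thesis
    unfolding isomorphic_def using bij_betw_trans[OF fg(1) fg'(1)] bij_betw_trans[OF fg(2) fg'(2)]
    by (intro exI[of _ "f' \<circ> f"] exI[of _ "g' \<circ> g"] conjI)
qed

lemma isomorphic_sym:
  assumes "isomorphic G H" "multigraph G"
  shows "isomorphic H G"
proof -
  obtain f g where fg: "bij_betw f (verts G) (verts H)" "bij_betw g (edges G) (edges H)"
    "\<forall>e\<in>edges G. ends H (g e) = f ` ends G e"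
    using assms(1) by (auto simp: isomorphic_def)
  let ?f = "inv_into (verts G) f" and ?g = "inv_into (edges G) g"
  have "ends G (?g e) = ?f ` ends H e" if e: "e \<in> edges H" for e
  proof -
    have ge: "?g e \<in> edges G" "g (?g e) = e"
      using fg(2) e by (auto simp: bij_betw_def inv_into_into f_inv_into_f)
    \<comment> \<open>The inverse of \<open>f\<close> undoes \<open>f\<close> only on
      \<open>verts G\<close>, hence the need for the ends to lie there.\<close>
    then have "ends G (?g e) \<subseteq> verts G" using assms(2) by (auto simp: multigraph_def)
    then have "?f ` f ` ends G (?g e) = ends G (?g e)"
      using fg(1) by (simp add: bij_betw_def inv_into_image_cancel)
    then show ?thesis using fg(3) ge by metis
  qed
  then show ?thesis
    unfolding isomorphic_def using bij_betw_inv_into[OF fg(1)] bij_betw_inv_into[OF fg(2)]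
    by (intro exI[of _ ?f] exI[of _ ?g] conjI ballI)
qed

lemma isomorphic_card:
  assumes "isomorphic G H"
  shows "card (verts G) = card (verts H)" "card (edges G) = card (edges H)"
  using assms bij_betw_same_card unfolding isomorphic_def by blast+

text \<open>Every copy of the hexagon represents the same class, so removing \<open>C6\<close>
  excludes them all.\<close>

lemma iso_class_C6:
  assumes "multigraph G" "isomorphic G (cycle_graph 6)"
  shows "iso_rel `` {G} = C6"
proof -
  have "isomorphic G H \<longleftrightarrow> isomorphic H (cycle_graph 6)" if "multigraph H" for H :: "('a, 'b) mgraph"
    using assms that isomorphic_sym isomorphic_trans by metis
  then show ?thesis using assms(1) by (auto simp: iso_rel_def C6_def)
qed

section \<open>The containment for graphs\<close>

lemma edge_extremal_imp_two_vertex_extremal: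
  assumes G: "edge_extremal G" and not_C6: "\<not> isomorphic G (cycle_graph 6)"
  shows "two_vertex_extremal G"
proof -
  obtain A B where AB: "bipartition G A B"
    using G by (auto simp: edge_extremal_def bipartite_iff)
  have "real (card (edges G)) = (3 * real (card (verts G)) - 6) / 2"
    using G by (simp add: edge_extremal_def)
  then have "real (2 * card (edges G) + 6) = real (3 * card (verts G))" by simp
  then have m: "2 * card (edges G) + 6 = 3 * card (verts G)" by (simp only: of_nat_eq_iff)
  interpret extremal_bipartite G A B
    using G AB m by unfold_locales (auto simp: edge_extremal_def)
  have "card (V2 G) + 2 = card (verts G)" using V2_or_cycle not_C6 by blast
  \<comment> \<open>From 2m = 3n - 6 the required number 2(m - n + 2) equals n - 2.\<close>
  then show ?thesis using G m by (auto simp: edge_extremal_def two_vertex_extremal_def)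
qed

section \<open>The four-cycle\<close>

lemma two_vertex_extremal_C4:
  obtains G :: "('v::infinite, 'e::infinite) mgraph" where "two_vertex_extremal G"
    "card (verts G) = 4" "card (edges G) = 4"
proof -
  obtain v :: "nat \<Rightarrow> 'v" where v: "inj v"
    using infinite_countable_subset[OF infinite_UNIV] by blast
  obtain w :: "nat \<Rightarrow> 'e" where w: "inj w"
    using infinite_countable_subset[OF infinite_UNIV] by blast
  define v0 v1 v2 v3 where vs: "v0 = v 0" "v1 = v 1" "v2 = v 2" "v3 = v 3"
  define e0 e1 e2 e3 where es: "e0 = w 0" "e1 = w 1" "e2 = w 2" "e3 = w 3"
  have dv: "distinct [v0, v1, v2, v3]" using v by (auto simp: vs inj_eq)
  have de: "distinct [e0, e1, e2, e3]" using w by (auto simp: es inj_eq)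
  define G where "G = \<lparr>verts = {v0, v1, v2, v3}, edges = {e0, e1, e2, e3},
    ends = (\<lambda>e. if e = e0 then {v0, v1} else if e = e1 then {v1, v2}
      else if e = e2 then {v2, v3} else {v3, v0})\<rparr>"
  have G: "verts G = {v0, v1, v2, v3}" "edges G = {e0, e1, e2, e3}"
    "ends G e0 = {v0, v1}" "ends G e1 = {v1, v2}" "ends G e2 = {v2, v3}" "ends G e3 = {v3, v0}"
    using de by (auto simp: G_def)
  have card: "card (verts G) = 4" "card (edges G) = 4" using dv de by (auto simp: G)
  have mg: "multigraph G" using dv by (auto simp: multigraph_def G)
  have bip: "bipartition G {v0, v2} {v1, v3}" using dv by (auto simp: bipartition_def G)
  let ?S = "incident G {v0, v2} {v1, v3}"
  have S: "(v0, v1) \<in> ?S" "(v0, v3) \<in> ?S" "(v2, v1) \<in> ?S" "(v2, v3) \<in> ?S"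
    by (auto simp: incident_def G insert_commute)
  define \<mu> where "\<mu> = (\<lambda>x. if x = v0 then v1 else v3)"
  have "matching_map {v0, v2} {v1, v3} ?S \<mu>"
    using S dv by (auto simp: matching_map_def \<mu>_def bij_betw_def inj_on_def)
  moreover have "(v0, v2) \<in> contraction {v0, v2} ?S \<mu>" "(v2, v0) \<in> contraction {v0, v2} ?S \<mu>"
    using S dv by (auto simp: contraction_def \<mu>_def)
  then have "strong_on {v0, v2} (contraction {v0, v2} ?S \<mu>)" by (auto simp: strong_on_def)
  ultimately have mc: "matching_covered G" using matching_coveredI[OF bip mg] card by simp
  \<comment> \<open>Without \<open>d\<close> the edge \<open>h\<close> is the only one left at
    \<open>x\<close>, so it is in every perfect matching; \<open>g\<close> meets \<open>h\<close> in
    \<open>y\<close> and is in none.\<close>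
  have *: "\<not> matching_covered (delete_edge G d)"
    if g: "g \<in> edges G" "g \<noteq> d" "h \<noteq> g" and x: "x \<in> verts G"
      and xe: "\<forall>e\<in>edges G. x \<in> ends G e \<longrightarrow> e = d \<or> e = h"
      and y: "y \<in> ends G g" "y \<in> ends G h" "y \<in> verts G" for d g h x y
  proof
    assume mcd: "matching_covered (delete_edge G d)"
    have "g \<in> edges (delete_edge G d)" using g by (simp add: delete_edge_def)
    then obtain M where M: "perfect_matching (delete_edge G d) M" "g \<in> M"
      using mcd by (auto simp: matching_covered_def)
    have sub: "M \<subseteq> edges G - {d}" and ends: "ends (delete_edge G d) = ends G"
      using M(1) by (auto simp: perfect_matching_def delete_edge_def)
    have ex1: "\<exists>!e. e \<in> M \<and> u \<in> ends G e" if "u \<in> verts G" for u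
      using M(1) that ends by (simp add: perfect_matching_def)
    obtain e where "e \<in> M" "x \<in> ends G e" using ex1[OF x] by blast
    then have "h \<in> M" using xe sub by blast
    then show False using ex1[OF y(3)] M(2) y(1,2) g(3) by blast
  qed
  have "\<not> matching_covered (delete_edge G d)" if d: "d \<in> edges G" for d
  proof -
    consider "d = e0" | "d = e1" | "d = e2" | "d = e3" using d by (auto simp: G)
    then show ?thesis
    proof cases
      case 1
      then show ?thesis using dv de by (intro *[of e2 d e3 v0 v3]) (auto simp: G)
    next
      case 2
      then show ?thesis using dv de by (intro *[of e3 d e2 v2 v3]) (auto simp: G)
    next
      case 3
      then show ?thesis using dv de by (intro *[of e0 d e1 v2 v1]) (auto simp: G)
    next
      case 4
      then show ?thesis using dv de by (intro *[of e1 d e0 v0 v1]) (auto simp: G)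
    qed
  qed
  then have min: "minimal_matching_covered G" using mc by (auto simp: minimal_matching_covered_def)
  have "bipartite G" unfolding bipartite_iff using bip by (intro exI)
  moreover have "{e \<in> edges G. v0 \<in> ends G e} = {e0, e3}" "{e \<in> edges G. v1 \<in> ends G e} = {e0, e1}"
    "{e \<in> edges G. v2 \<in> ends G e} = {e1, e2}" "{e \<in> edges G. v3 \<in> ends G e} = {e2, e3}"
    using dv de by (auto simp: G)
  then have "V2 G = verts G" using de by (auto simp: V2_def degree_def G)
  \<comment> \<open>All four vertices have degree two, and 2(4 - 4 + 2) = 4.\<close>
  ultimately have "two_vertex_extremal G" using min card by (simp add: two_vertex_extremal_def)
  then show ?thesis using that card by blast
qed

section \<open>Proper containment of the isomorphism classes\<close>

theorem corollary7p4:
  "(H4 :: ('v::infinite, 'e::infinite) mgraph set set) - {C6} \<subset> H2"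
proof (rule psubsetI)
  show "(H4 :: ('v, 'e) mgraph set set) - {C6} \<subseteq> H2"
  proof
    fix X :: "('v, 'e) mgraph set" assume X: "X \<in> H4 - {C6}"
    then obtain G where G: "edge_extremal G" "X = iso_rel `` {G}"
      by (auto simp: H4_def elim: quotientE)
    then have "multigraph G"
      by (simp add: edge_extremal_def minimal_matching_covered_def matching_covered_def)
    then have "\<not> isomorphic G (cycle_graph 6)" using X G(2) iso_class_C6 by blast
    then have "two_vertex_extremal G" using G(1) by (rule edge_extremal_imp_two_vertex_extremal[rotated])
    then show "X \<in> H2" unfolding H2_def G(2) by (intro quotientI) simp
  qed
  obtain G :: "('v, 'e) mgraph" where G: "two_vertex_extremal G" "card (verts G) = 4" "card (edges G) = 4"
    using two_vertex_extremal_C4 .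
  have mg: "multigraph G"
    using G(1) by (simp add: two_vertex_extremal_def minimal_matching_covered_def matching_covered_def)
  have "iso_rel `` {G} \<in> H2" using G(1) unfolding H2_def by (intro quotientI) simp
  moreover have "iso_rel `` {G} \<notin> H4"
  proof
    assume "iso_rel `` {G} \<in> H4"
    then obtain K where K: "edge_extremal K" "iso_rel `` {G} = iso_rel `` {K}"
      by (auto simp: H4_def elim: quotientE)
    have "G \<in> iso_rel `` {G}" using mg by (simp add: iso_rel_def isomorphic_refl)
    then have "G \<in> iso_rel `` {K}" by (simp only: K(2))
    then have "isomorphic K G" by (simp add: iso_rel_def)
    then have "card (verts K) = 4" "card (edges K) = 4" using isomorphic_card[of K G] G(2,3) by simp_all
    \<comment> \<open>Edge extremality on four vertices would require (12 - 6) / 2 = 3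
      edges.\<close>
    then show False using K(1) by (simp add: edge_extremal_def)
  qed
  ultimately show "(H4 :: ('v, 'e) mgraph set set) - {C6} \<noteq> H2" by blast
qed

end
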